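(* Let $n\ge 2$. The Cayley graphs $\mathrm{Cay}(\mathbf{F}_n,\mathcal{C}^{\mathrm{sep}})$ and $\mathrm{Cay}(\mathbf{F}_n,\mathcal{C}^{\mathrm{prim}})$ are nonhyperbolic, i.e. neither is a Gromov-hyperbolic metric space.
   Context: $\mathbf{F}_n$ is the free group of rank $n$. A proper free factor of $\mathbf{F}_n$ is a nontrivial proper subgroup $F$ such that $\mathbf{F}_n=F*G$ for some nontrivial proper subgroup $G$. $\mathcal{C}^{\mathrm{sep}}$ is the set of elements of $\mathbf{F}_n$ lying in some proper free factor (separable elements), and $\mathcal{C}^{\mathrm{prim}}$ is the set of all primitive elements of $\mathbf{F}_n$ (elements belonging to some basis). For a group $G$ and a subset $S\subseteq G$, the Cayley graph $\mathrm{Cay}(G,S)$ is the directed graph with vertex set $G$ and an edge labeled $s\in S$ from $v$ to $w$ whenever $vs=w$ in $G$; it carries the path metric (ignoring orientations) with each edge of length one. Hyperbolic means that there is $\delta\geq 0$ such that each side of every geodesic triangle lies in the $\delta$-neighborhood of the union of the other two sides. *)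

theory Defs
  imports Complex_Main "HOL-Algebra.Generated_Groups" "Graph_Theory.Digraph"
begin

section \<open>Free groups, free products and free factors\<close>

definition word_value :: "('a, 'm) monoid_scheme \<Rightarrow> ('a \<times> bool) list \<Rightarrow> 'a" where
  "word_value G w =
     foldr (\<lambda>(b, e) g. (if e then b else inv\<^bsub>G\<^esub> b) \<otimes>\<^bsub>G\<^esub> g) w \<one>\<^bsub>G\<^esub>"

definition reduced_word :: "('a \<times> bool) list \<Rightarrow> bool" where
  "reduced_word w \<longleftrightarrow> successively (\<lambda>(a, e) (b, f). \<not> (a = b \<and> e \<noteq> f)) w"

definition free_basis :: "('a, 'm) monoid_scheme \<Rightarrow> 'a set \<Rightarrow> bool" where
  "free_basis G B \<longleftrightarrow>
     B \<subseteq> carrier G \<and> generate G B = carrier G \<and>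
     (\<forall>w. w \<noteq> [] \<longrightarrow> set w \<subseteq> B \<times> UNIV \<longrightarrow> reduced_word w \<longrightarrow> word_value G w \<noteq> \<one>\<^bsub>G\<^esub>)"

definition free_group_of_rank :: "('a, 'm) monoid_scheme \<Rightarrow> nat \<Rightarrow> bool" where
  "free_group_of_rank G n \<longleftrightarrow>
     group G \<and> (\<exists>B. free_basis G B \<and> finite B \<and> card B = n)"

text \<open>
  \<open>G = H * K\<close> as an internal free product, by the normal form criterion.  Syllables carry a tag
  (True for \<open>H\<close>, False for \<open>K\<close>), so that a common nontrivial element \<open>x\<close> of the two factors is
  excluded by the alternating word \<open>x, x\<^sup>-\<^sup>1\<close>.
\<close>

definition free_product_decomp :: "('a, 'm) monoid_scheme \<Rightarrow> 'a set \<Rightarrow> 'a set \<Rightarrow> bool" where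
  "free_product_decomp G H K \<longleftrightarrow>
     subgroup H G \<and> subgroup K G \<and> generate G (H \<union> K) = carrier G \<and>
     (\<forall>w. w \<noteq> [] \<longrightarrow>
        (\<forall>(i, x) \<in> set w. x \<in> (if i then H else K) \<and> x \<noteq> \<one>\<^bsub>G\<^esub>) \<longrightarrow>
        successively (\<lambda>(i, x) (j, y). i \<noteq> j) w \<longrightarrow>
        foldr (\<lambda>(i, x) g. x \<otimes>\<^bsub>G\<^esub> g) w \<one>\<^bsub>G\<^esub> \<noteq> \<one>\<^bsub>G\<^esub>)"

definition nontrivial_proper_subgroup :: "('a, 'm) monoid_scheme \<Rightarrow> 'a set \<Rightarrow> bool" where
  "nontrivial_proper_subgroup G H \<longleftrightarrow> subgroup H G \<and> H \<noteq> {\<one>\<^bsub>G\<^esub>} \<and> H \<noteq> carrier G"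

definition proper_free_factor :: "('a, 'm) monoid_scheme \<Rightarrow> 'a set \<Rightarrow> bool" where
  "proper_free_factor G H \<longleftrightarrow>
     nontrivial_proper_subgroup G H \<and>
     (\<exists>K. nontrivial_proper_subgroup G K \<and> free_product_decomp G H K)"

definition separable_elements :: "('a, 'm) monoid_scheme \<Rightarrow> 'a set" where
  "separable_elements G = {g. \<exists>H. proper_free_factor G H \<and> g \<in> H}"

definition primitive_elements :: "('a, 'm) monoid_scheme \<Rightarrow> 'a set" where
  "primitive_elements G = {g. \<exists>B. free_basis G B \<and> g \<in> B}"

section \<open>Cayley graphs and the path metric of a graph\<close>

definition cayley_graph :: "('a, 'm) monoid_scheme \<Rightarrow> 'a set \<Rightarrow> ('a, 'a \<times> 'a) pre_digraph" where
  "cayley_graph G S =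
     \<lparr>verts = carrier G, arcs = carrier G \<times> S,
      tail = (\<lambda>(v, s). v), head = (\<lambda>(v, s). v \<otimes>\<^bsub>G\<^esub> s)\<rparr>"

text \<open>
  Points of the geometric realization, every arc being a copy of the unit interval:
  \<open>Inner a t\<close> with \<open>0 < t < 1\<close> is the point of the arc \<open>a\<close> at distance \<open>t\<close> along \<open>a\<close> from its tail.
\<close>

datatype ('v, 'e) graph_point = Vertex 'v | Inner 'e real

definition realization :: "('v, 'e) pre_digraph \<Rightarrow> ('v, 'e) graph_point set" where
  "realization \<Gamma> = Vertex ` verts \<Gamma> \<union> {Inner a t | a t. a \<in> arcs \<Gamma> \<and> 0 < t \<and> t < 1}"

definition joined_by_walk :: "('v, 'e) pre_digraph \<Rightarrow> nat \<Rightarrow> 'v \<Rightarrow> 'v \<Rightarrow> bool" where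
  "joined_by_walk \<Gamma> k u v \<longleftrightarrow> (u, v) \<in> (arcs_ends \<Gamma> \<union> (arcs_ends \<Gamma>)\<inverse>) ^^ k"

text \<open>The ends of the open arc containing a point, with the length of the arc segment to each.\<close>

fun exits :: "('v, 'e) pre_digraph \<Rightarrow> ('v, 'e) graph_point \<Rightarrow> ('v \<times> real) set" where
  "exits \<Gamma> (Vertex v) = {(v, 0)}"
| "exits \<Gamma> (Inner a t) = {(tail \<Gamma> a, t), (head \<Gamma> a, 1 - t)}"

text \<open>
  Lengths of paths between two points: either the path stays inside one arc, or it leaves the arc
  of the first point through an end, follows a walk (orientations ignored), and enters the arc of
  the second point through an end.  The infimum is meaningful for connected graphs only.
\<close>

definition path_lengths ::
  "('v, 'e) pre_digraph \<Rightarrow> ('v, 'e) graph_point \<Rightarrow> ('v, 'e) graph_point \<Rightarrow> real set" where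
  "path_lengths \<Gamma> x y =
     {\<bar>t - s\<bar> | a t s. x = Inner a t \<and> y = Inner a s} \<union>
     {p + real k + q | u p v q k. (u, p) \<in> exits \<Gamma> x \<and> (v, q) \<in> exits \<Gamma> y \<and> joined_by_walk \<Gamma> k u v}"

definition path_dist ::
  "('v, 'e) pre_digraph \<Rightarrow> ('v, 'e) graph_point \<Rightarrow> ('v, 'e) graph_point \<Rightarrow> real" where
  "path_dist \<Gamma> x y = Inf (path_lengths \<Gamma> x y)"

section \<open>Gromov hyperbolicity\<close>

definition geodesic_segment ::
  "'p set \<Rightarrow> ('p \<Rightarrow> 'p \<Rightarrow> real) \<Rightarrow> 'p \<Rightarrow> 'p \<Rightarrow> 'p set \<Rightarrow> bool" where
  "geodesic_segment M d x y A \<longleftrightarrow>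
     (\<exists>(\<gamma> :: real \<Rightarrow> 'p) L. 0 \<le> L \<and> \<gamma> ` {0..L} = A \<and> A \<subseteq> M \<and> \<gamma> 0 = x \<and> \<gamma> L = y \<and>
        (\<forall>s\<in>{0..L}. \<forall>t\<in>{0..L}. d (\<gamma> s) (\<gamma> t) = \<bar>s - t\<bar>))"

definition neighborhood :: "'p set \<Rightarrow> ('p \<Rightarrow> 'p \<Rightarrow> real) \<Rightarrow> real \<Rightarrow> 'p set \<Rightarrow> 'p set" where
  "neighborhood M d r A = {p \<in> M. \<exists>q\<in>A. d p q \<le> r}"

definition gromov_hyperbolic :: "'p set \<Rightarrow> ('p \<Rightarrow> 'p \<Rightarrow> real) \<Rightarrow> bool" where
  "gromov_hyperbolic M d \<longleftrightarrow>
     (\<exists>\<delta>\<ge>0. \<forall>x y z A B C.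
        geodesic_segment M d x y A \<and> geodesic_segment M d y z B \<and> geodesic_segment M d z x C \<longrightarrow>
        A \<subseteq> neighborhood M d \<delta> (B \<union> C) \<and>
        B \<subseteq> neighborhood M d \<delta> (C \<union> A) \<and>
        C \<subseteq> neighborhood M d \<delta> (A \<union> B))"

definition hyperbolic_graph :: "('v, 'e) pre_digraph \<Rightarrow> bool" where
  "hyperbolic_graph \<Gamma> \<longleftrightarrow> gromov_hyperbolic (realization \<Gamma>) (path_dist \<Gamma>)"

end

theory Submission
  imports Defs "HOL-Library.Sublist"
begin

text \<open>
  The word norm of a conjugation-invariant generating set is bi-invariant. If it were hyperbolic, the
  four-point inequality would force two elements \<open>g\<close>, \<open>h\<close> of nearly equal norm to satisfy that
  \<open>g h\<close> or \<open>g\<^sup>-\<^sup>1 h\<close> has bounded norm: the group would look like a line. This contradicts the existence of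
  two independent quasimorphisms that are bounded on the generators.

  Such quasimorphisms are the Brooks counting functions of words \<open>w\<close> in which every reduced word of
  length two occurs. They are bounded on separable elements by Whitehead's cut vertex lemma: a free
  splitting \<open>F = H * K\<close> yields a set \<open>P\<close> of elements (the identity and those whose normal form starts in \<open>H\<close>) that has
  finite boundary in the Cayley tree and is invariant under right multiplication by \<open>H\<close>, whereas
  invariance under a conjugate of an element whose cyclically reduced form contains \<open>w\<close> would
  force \<open>P\<close> or its complement to be finite.
\<close>

section \<open>Slim triangles and the four-point condition\<close>

text \<open>One argument serves both generating sets: in rank at least two every primitive element
  is separable, and the proof asks of the generators only that they generate, are separable and are
  closed under inversion and conjugation. Hyperbolicity is a statement about all points of the
  realization, but only triangles spanned by vertices are used, and they turn it into an inequality
  between integer distances.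

  No growth of the word norm along powers is known beforehand; the quasimorphisms supply it. There
  are two elements \<open>g 0\<close> and \<open>g 1\<close> such that \<open>\<phi> 0\<close> grows
  linearly on the powers of \<open>g 0\<close> and vanishes on those of \<open>g 1\<close>, while
  \<open>\<phi> 1\<close> grows linearly on the powers of \<open>g 1\<close>. Hence the powers of
  \<open>g 1\<close> have unbounded norm, and one of them can be matched in norm with a high power
  of \<open>g 0\<close>. The geometry then says that the product of the two, or of one with the
  inverse of the other, is short, and \<open>\<phi> 0\<close> refutes this.\<close>

definition graph_dist :: "('v, 'e) pre_digraph \<Rightarrow> 'v \<Rightarrow> 'v \<Rightarrow> nat" where
  "graph_dist \<Gamma> u v = (LEAST k. joined_by_walk \<Gamma> k u v)"

lemma joined_by_walk_0 [simp]: "joined_by_walk \<Gamma> 0 u v \<longleftrightarrow> u = v"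
  by (simp add: joined_by_walk_def)

lemma joined_by_walk_trans:
  "joined_by_walk \<Gamma> k u v \<Longrightarrow> joined_by_walk \<Gamma> l v w \<Longrightarrow> joined_by_walk \<Gamma> (k + l) u w"
  by (auto simp: joined_by_walk_def relpow_add)

lemma joined_by_walk_sym: "joined_by_walk \<Gamma> k u v \<Longrightarrow> joined_by_walk \<Gamma> k v u"
proof (induction k arbitrary: v)
  case (Suc k)
  then obtain w where w: "joined_by_walk \<Gamma> k u w" "joined_by_walk \<Gamma> 1 w v"
    by (auto simp: joined_by_walk_def)
  then have "joined_by_walk \<Gamma> 1 v w"
    by (auto simp: joined_by_walk_def)
  then show ?case
    using Suc.IH[OF w(1)] joined_by_walk_trans[of \<Gamma> 1 v w k u] by simp
qed simp

text \<open>By symmetry every undirected walk can be followed along arcs in their own direction, so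
  geodesics may be taken to run from tails to heads.\<close>

locale connected_sym_digraph = sym_digraph G for G :: "('v, 'e) pre_digraph" (structure) +
  assumes connected: "u \<in> verts G \<Longrightarrow> v \<in> verts G \<Longrightarrow> \<exists>k. joined_by_walk G k u v"
begin

abbreviation gd :: "'v \<Rightarrow> 'v \<Rightarrow> nat" where
  "gd \<equiv> graph_dist G"

lemma graph_dist_le: "joined_by_walk G k u v \<Longrightarrow> gd u v \<le> k"
  unfolding graph_dist_def by (rule Least_le)

lemma joined_by_walk_graph_dist:
  "u \<in> verts G \<Longrightarrow> v \<in> verts G \<Longrightarrow> joined_by_walk G (gd u v) u v"
  unfolding graph_dist_def using connected by (rule LeastI_ex)

lemma graph_dist_refl [simp]: "gd u u = 0"
  using graph_dist_le[of 0 u u] by simp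

lemma graph_dist_sym: "gd u v = gd v u"
  unfolding graph_dist_def by (rule arg_cong[where f = Least]) (blast intro: joined_by_walk_sym)

lemma graph_dist_triangle:
  "u \<in> verts G \<Longrightarrow> v \<in> verts G \<Longrightarrow> w \<in> verts G \<Longrightarrow> gd u w \<le> gd u v + gd v w"
  by (rule graph_dist_le) (rule joined_by_walk_trans; rule joined_by_walk_graph_dist)

section \<open>Shortest walks and the geodesic segments that they trace in the realization\<close>

definition geodesic_path :: "'v \<Rightarrow> 'v \<Rightarrow> (nat \<Rightarrow> 'v) \<Rightarrow> bool" where
  "geodesic_path u v p \<longleftrightarrow> p 0 = u \<and> p (gd u v) = v \<and>
     (\<forall>i\<le>gd u v. p i \<in> verts G) \<and>
     (\<forall>i<gd u v. (p i, p (Suc i)) \<in> arcs_ends G) \<and>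
     (\<forall>i\<le>gd u v. \<forall>j\<le>gd u v. int (gd (p i) (p j)) = \<bar>int i - int j\<bar>)"

lemma geodesic_pathD:
  assumes "geodesic_path u v p"
  shows "p 0 = u" and "p (gd u v) = v"
    and "i \<le> gd u v \<Longrightarrow> p i \<in> verts G"
    and "i < gd u v \<Longrightarrow> (p i, p (Suc i)) \<in> arcs_ends G"
    and "i \<le> gd u v \<Longrightarrow> j \<le> gd u v \<Longrightarrow> int (gd (p i) (p j)) = \<bar>int i - int j\<bar>"
  using assms unfolding geodesic_path_def by simp_all

lemma geodesic_path_exists:
  assumes u: "u \<in> verts G" and v: "v \<in> verts G"
  obtains p where "geodesic_path u v p"
proof -
  let ?N = "gd u v"
  have E: "arcs_ends G \<union> (arcs_ends G)\<inverse> = arcs_ends G"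
    using sym_arcs by (auto simp: symmetric_def sym_def)
  have "(u, v) \<in> arcs_ends G ^^ ?N"
    using joined_by_walk_graph_dist[OF u v] by (simp add: joined_by_walk_def E)
  then obtain p where p: "p 0 = u" "p ?N = v" "\<And>i. i < ?N \<Longrightarrow> (p i, p (Suc i)) \<in> arcs_ends G"
    unfolding relpow_fun_conv by blast
  have vert: "p i \<in> verts G" if "i \<le> ?N" for i
  proof (cases i)
    case (Suc j)
    then show ?thesis
      using p(3)[of j] that by (auto simp: arcs_ends_conv)
  qed (use p u in simp)
  have walk: "joined_by_walk G (j - i) (p i) (p j)" if "i \<le> j" "j \<le> ?N" for i j
    using that
  proof (induction j rule: dec_induct)
    case (step m)
    have "joined_by_walk G 1 (p m) (p (Suc m))"
      using p(3)[of m] step by (auto simp: joined_by_walk_def)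
    then show ?case
      using joined_by_walk_trans[of G "m - i" "p i" "p m" 1 "p (Suc m)"] step
      by (simp add: Suc_diff_le)
  qed simp
  \<comment> \<open>A shortcut between \<open>p i\<close> and \<open>p j\<close> would shorten the
    whole walk from \<open>u\<close> to \<open>v\<close>.\<close>
  have le: "gd (p i) (p j) = j - i" if "i \<le> j" "j \<le> ?N" for i j
  proof (rule antisym)
    show "gd (p i) (p j) \<le> j - i"
      using walk[OF that] by (rule graph_dist_le)
    have "gd u v \<le> gd u (p i) + (gd (p i) (p j) + gd (p j) v)"
      by (meson graph_dist_triangle add_left_mono le_trans that u v vert)
    moreover have "gd u (p i) \<le> i" "gd (p j) v \<le> ?N - j"
      using walk[of 0 i] walk[of j ?N] that p graph_dist_le by auto
    ultimately show "j - i \<le> gd (p i) (p j)"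
      using that by linarith
  qed
  have "int (gd (p i) (p j)) = \<bar>int i - int j\<bar>" if "i \<le> ?N" "j \<le> ?N" for i j
    using le[of i j] le[of j i] that graph_dist_sym[of "p i" "p j"] by (cases "i \<le> j") auto
  then have "geodesic_path u v p"
    unfolding geodesic_path_def using p vert by blast
  then show ?thesis
    by (rule that)
qed

text \<open>Parallel arcs may lead from \<open>p k\<close> to \<open>p (Suc k)\<close>. The choice
  by \<open>SOME\<close> depends only on these two vertices, so an open unit interval is mapped into
  one and the same arc. The arcs run forward along \<open>p\<close>, hence the position measured
  from the tail is \<open>t - real k\<close>.\<close>

definition realized_path :: "(nat \<Rightarrow> 'v) \<Rightarrow> real \<Rightarrow> ('v, 'e) graph_point" where
  "realized_path p t = (let k = nat \<lfloor>t\<rfloor> in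
     if t = real k then Vertex (p k)
     else Inner (SOME a. a \<in> arcs G \<and> tail G a = p k \<and> head G a = p (Suc k)) (t - real k))"

lemma realized_path_of_nat [simp]: "realized_path p (real k) = Vertex (p k)"
  by (simp add: realized_path_def)

context
  fixes u v :: 'v and p :: "nat \<Rightarrow> 'v"
  assumes p: "geodesic_path u v p"
begin

lemma realized_path_cases:
  assumes "0 \<le> t" "t \<le> real (gd u v)"
  obtains (vertex) k where "k \<le> gd u v" "t = real k" "realized_path p t = Vertex (p k)"
  | (inner) k a where "k < gd u v" "real k < t" "t < real (Suc k)"
      "realized_path p t = Inner a (t - real k)" "a \<in> arcs G" "tail G a = p k" "head G a = p (Suc k)"
      "\<And>s. real k < s \<Longrightarrow> s < real (Suc k) \<Longrightarrow> realized_path p s = Inner a (s - real k)"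
proof (cases "t = real (nat \<lfloor>t\<rfloor>)")
  case True
  then show ?thesis
    using vertex[of "nat \<lfloor>t\<rfloor>"] assms by (metis of_nat_le_iff realized_path_of_nat)
next
  case False
  define k where "k = nat \<lfloor>t\<rfloor>"
  have k: "real k < t" "t < real (Suc k)"
    using False assms unfolding k_def by linarith+
  then have "k < gd u v"
    using assms(2) by linarith
  then have "\<exists>a. a \<in> arcs G \<and> tail G a = p k \<and> head G a = p (Suc k)"
    using geodesic_pathD(4)[OF p] by (metis reachableE)
  note a = someI_ex[OF this]
  have "realized_path p s = Inner (SOME a. a \<in> arcs G \<and> tail G a = p k \<and> head G a = p (Suc k)) (s - real k)"
    if "real k < s" "s < real (Suc k)" for s
  proof -
    have "nat \<lfloor>s\<rfloor> = k"
      using that by linarith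
    then show ?thesis
      using that by (simp add: realized_path_def)
  qed
  then show ?thesis
    using inner[OF \<open>k < gd u v\<close> k _ conjunct1[OF a]] a k by blast
qed

lemma exits_realized_path:
  assumes "0 \<le> t" "t \<le> real (gd u v)" "(x, q) \<in> exits G (realized_path p t)"
  obtains i where "i \<le> gd u v" "x = p i" "q = \<bar>t - real i\<bar>"
  using assms(1,2)
proof (cases rule: realized_path_cases)
  case (vertex k)
  then show ?thesis
    using assms that[of k] by simp
next
  case (inner k a)
  then show ?thesis
    using assms that[of k] that[of "Suc k"] by auto
qed

lemma exits_realized_path_floor:
  assumes "0 \<le> t" "t \<le> real (gd u v)"
  shows "(p (nat \<lfloor>t\<rfloor>), t - real (nat \<lfloor>t\<rfloor>)) \<in> exits G (realized_path p t)"
  using assms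
proof (cases rule: realized_path_cases)
  case (inner k a)
  then have "nat \<lfloor>t\<rfloor> = k"
    by linarith
  then show ?thesis
    using inner by simp
qed simp

lemma exits_realized_path_ceiling:
  assumes "0 \<le> t" "t \<le> real (gd u v)"
  shows "(p (nat \<lceil>t\<rceil>), real (nat \<lceil>t\<rceil>) - t) \<in> exits G (realized_path p t)"
  using assms
proof (cases rule: realized_path_cases)
  case (inner k a)
  then have "nat \<lceil>t\<rceil> = Suc k"
    by linarith
  then show ?thesis
    using inner by simp
qed simp

text \<open>If both points lie on a common arc, its tail determines its index, because a geodesic
  path visits no vertex twice. A path through exits contains a walk between some \<open>p i\<close>
  and \<open>p j\<close>, which has at least \<open>\<bar>i - j\<bar>\<close> arcs; the triangle
  inequality on the real line gives the rest.\<close>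

lemma path_lengths_realized_path_ge:
  assumes s: "0 \<le> s" "s \<le> real (gd u v)" and t: "0 \<le> t" "t \<le> real (gd u v)"
    and l: "l \<in> path_lengths G (realized_path p s) (realized_path p t)"
  shows "\<bar>s - t\<bar> \<le> l"
  using l unfolding path_lengths_def
proof (elim UnE)
  assume "l \<in> {\<bar>t' - s'\<bar> | a t' s'. realized_path p s = Inner a t' \<and> realized_path p t = Inner a s'}"
  then obtain a t' s' where a: "l = \<bar>t' - s'\<bar>" "realized_path p s = Inner a t'" "realized_path p t = Inner a s'"
    by blast
  obtain i where i: "i < gd u v" "tail G a = p i" "t' = s - real i"
    using s a(2) by (cases rule: realized_path_cases) auto
  obtain j where j: "j < gd u v" "tail G a = p j" "s' = t - real j"
    using t a(3) by (cases rule: realized_path_cases) auto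
  have "int (gd (p i) (p j)) = \<bar>int i - int j\<bar>"
    using geodesic_pathD(5)[OF p, of i j] i j by simp
  then have "i = j"
    using i j by simp
  then show ?thesis
    using a i j by simp
next
  assume "l \<in> {q + real k + r | x q y r k. (x, q) \<in> exits G (realized_path p s) \<and>
             (y, r) \<in> exits G (realized_path p t) \<and> joined_by_walk G k x y}"
  then obtain x q y r k where l: "l = q + real k + r" and x: "(x, q) \<in> exits G (realized_path p s)"
    and y: "(y, r) \<in> exits G (realized_path p t)" and k: "joined_by_walk G k x y"
    by blast
  obtain i where i: "i \<le> gd u v" "x = p i" "q = \<bar>s - real i\<bar>"
    using exits_realized_path[OF s x] by blast
  obtain j where j: "j \<le> gd u v" "y = p j" "r = \<bar>t - real j\<bar>"
    using exits_realized_path[OF t y] by blast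
  have "int (gd (p i) (p j)) = \<bar>int i - int j\<bar>"
    using geodesic_pathD(5)[OF p, of i j] i j by simp
  then have "\<bar>int i - int j\<bar> \<le> int k"
    using graph_dist_le[OF k] i j by simp
  then have "\<bar>real i - real j\<bar> \<le> real k"
    by linarith
  then show ?thesis
    using l i j by linarith
qed

text \<open>If an integer lies between \<open>s\<close> and \<open>t\<close>, the path passes
  through the vertices at the ceiling of \<open>s\<close> and the floor of \<open>t\<close>.
  Otherwise both points are interior to the same arc.\<close>

lemma path_lengths_realized_path:
  assumes s: "0 \<le> s" and st: "s \<le> t" and t: "t \<le> real (gd u v)"
  shows "t - s \<in> path_lengths G (realized_path p s) (realized_path p t)"
proof (cases "nat \<lceil>s\<rceil> \<le> nat \<lfloor>t\<rfloor>")
  case True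
  have t0: "0 \<le> t" and s': "s \<le> real (gd u v)"
    using s st t by auto
  define m n where "m = nat \<lceil>s\<rceil>" and "n = nat \<lfloor>t\<rfloor>"
  have mn: "m \<le> n" "n \<le> gd u v"
    using True t t0 unfolding m_def n_def by linarith+
  then have "gd (p m) (p n) = n - m"
    using geodesic_pathD(5)[OF p, of m n] by linarith
  moreover have "p m \<in> verts G" "p n \<in> verts G"
    using geodesic_pathD(3)[OF p] mn by auto
  ultimately have "joined_by_walk G (n - m) (p m) (p n)"
    using joined_by_walk_graph_dist by metis
  moreover have "t - s = (real m - s) + real (n - m) + (t - real n)"
    using mn by (simp add: of_nat_diff)
  ultimately show ?thesis
    unfolding path_lengths_def
    using exits_realized_path_ceiling[OF s s'] exits_realized_path_floor[OF t0 t]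
    unfolding m_def[symmetric] n_def[symmetric] by blast
next
  case False
  define k where "k = nat \<lfloor>t\<rfloor>"
  have k: "real k < s" "t < real (Suc k)"
    using False s st unfolding k_def by linarith+
  have "0 \<le> s" "s \<le> real (gd u v)"
    using s st t by auto
  then show ?thesis
  proof (cases rule: realized_path_cases)
    case (vertex m)
    then have "real k < real m" "real m < real (Suc k)"
      using k st by linarith+
    then show ?thesis
      by (simp only: of_nat_less_iff)
  next
    case (inner m a)
    then have "real m < real (Suc k)" "real k < real (Suc m)"
      using k st by linarith+
    then have m: "m = k"
      by (simp only: of_nat_less_iff)
    have "real k < t" "s < real (Suc k)"
      using k st by linarith+
    then have "realized_path p s = Inner a (s - real k)" "realized_path p t = Inner a (t - real k)"
      using inner(8)[unfolded m] k by blast+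
    then show ?thesis
      using st unfolding path_lengths_def by (intro UnI1 CollectI exI[of _ a] exI[of _ "s - real k"]
          exI[of _ "t - real k"]) auto
  qed
qed

end

lemma path_lengths_sym: "l \<in> path_lengths G x y \<Longrightarrow> l \<in> path_lengths G y x"
proof -
  assume "l \<in> path_lengths G x y"
  then consider a t s where "l = \<bar>t - s\<bar>" "x = Inner a t" "y = Inner a s"
    | a p b q k where "l = p + real k + q" "(a, p) \<in> exits G x" "(b, q) \<in> exits G y" "joined_by_walk G k a b"
    unfolding path_lengths_def by blast
  then show ?thesis
  proof cases
    case 1
    then show ?thesis
      unfolding path_lengths_def using abs_minus_commute by blast
  next
    case 2
    then have "l = q + real k + p"
      by simp
    moreover have "joined_by_walk G k b a"
      using 2(4) by (rule joined_by_walk_sym)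
    ultimately show ?thesis
      unfolding path_lengths_def using 2(2,3) by blast
  qed
qed

lemma path_dist_realized_path:
  assumes p: "geodesic_path u v p" and s: "0 \<le> s" "s \<le> real (gd u v)"
    and t: "0 \<le> t" "t \<le> real (gd u v)"
  shows "path_dist G (realized_path p s) (realized_path p t) = \<bar>s - t\<bar>"
proof -
  have "\<bar>s - t\<bar> \<in> path_lengths G (realized_path p s) (realized_path p t)"
  proof (cases "s \<le> t")
    case True
    then show ?thesis
      using path_lengths_realized_path[OF p s(1) True t(2)] by simp
  next
    case False
    then show ?thesis
      using path_lengths_sym[OF path_lengths_realized_path[OF p t(1) _ s(2)]] by simp
  qed
  then show ?thesis
    unfolding path_dist_def
    using path_lengths_realized_path_ge[OF p s t] by (intro cInf_eq_minimum)
qed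

lemma geodesic_segment_realized_path:
  assumes p: "geodesic_path u v p"
  shows "geodesic_segment (realization G) (path_dist G) (Vertex u) (Vertex v)
           (realized_path p ` {0..real (gd u v)})"
  unfolding geodesic_segment_def
proof (intro exI conjI)
  show "realized_path p ` {0..real (gd u v)} \<subseteq> realization G"
  proof (intro image_subsetI)
    fix t assume "t \<in> {0..real (gd u v)}"
    then have "0 \<le> t" "t \<le> real (gd u v)"
      by auto
    then show "realized_path p t \<in> realization G"
      by (cases rule: realized_path_cases[OF p])
        (use geodesic_pathD(3)[OF p] in \<open>auto simp: realization_def\<close>)
  qed
  show "realized_path p 0 = Vertex u"
    using geodesic_pathD(1)[OF p] realized_path_of_nat[of p 0] by simp
  show "realized_path p (real (gd u v)) = Vertex v"
    using geodesic_pathD(2)[OF p] by simp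
  show "\<forall>s\<in>{0..real (gd u v)}. \<forall>t\<in>{0..real (gd u v)}.
      path_dist G (realized_path p s) (realized_path p t) = \<bar>s - t\<bar>"
    using path_dist_realized_path[OF p] by auto
qed auto

section \<open>From slim triangles to the four-point inequality\<close>

lemma near_realized_path:
  assumes p: "geodesic_path u v p" "u \<in> verts G" "v \<in> verts G" and x: "x \<in> verts G"
    and t: "0 \<le> t" "t \<le> real (gd u v)"
    and d: "path_dist G (Vertex x) (realized_path p t) \<le> \<delta>"
  obtains i where "i \<le> gd u v" "real (gd x (p i)) < \<delta> + 1"
proof -
  let ?L = "path_lengths G (Vertex x) (realized_path p t)"
  let ?i = "nat \<lfloor>t\<rfloor>"
  have "?i \<le> gd u v"
    using t by linarith
  then have "p ?i \<in> verts G"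
    using p by (simp add: geodesic_path_def)
  then have "0 + real (gd x (p ?i)) + (t - real ?i) \<in> ?L"
    unfolding path_lengths_def
    using exits_realized_path_floor[OF p(1) t] joined_by_walk_graph_dist[OF x] by force
  then have "?L \<noteq> {}"
    by blast
  \<comment> \<open>The slack of one replaces an argument that the infimum is attained: some actual
    path is shorter than \<open>\<delta> + 1\<close>.\<close>
  moreover have "Inf ?L < \<delta> + 1"
    using d by (simp add: path_dist_def)
  ultimately obtain l where l: "l \<in> ?L" "l < \<delta> + 1"
    by (meson cInf_lessD)
  then obtain y q k where y: "(y, q) \<in> exits G (realized_path p t)" "joined_by_walk G k x y"
    "l = real k + q"
    unfolding path_lengths_def by auto
  obtain i where i: "i \<le> gd u v" "y = p i" "q = \<bar>t - real i\<bar>"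
    using exits_realized_path[OF p(1) t y(1)] by blast
  show ?thesis
  proof (rule that[OF i(1)])
    have "gd x (p i) \<le> k"
      using graph_dist_le[OF y(2)] i by simp
    then show "real (gd x (p i)) < \<delta> + 1"
      using y(3) l(2) i(3) by linarith
  qed
qed

text \<open>Half of the excess \<open>gd u m + gd m v - gd u v\<close> is the Gromov product of
  \<open>u\<close> and \<open>v\<close> at \<open>m\<close>. The condition says that
  \<open>m\<close> lies on a geodesic from \<open>u\<close> to \<open>v\<close> up to an error,
  without mentioning a geodesic.\<close>

definition near_geodesic :: "nat \<Rightarrow> 'v \<Rightarrow> 'v \<Rightarrow> 'v \<Rightarrow> bool" where
  "near_geodesic C u m v \<longleftrightarrow> gd u m + gd m v \<le> gd u v + C"

definition slim_triangles :: "real \<Rightarrow> bool" where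
  "slim_triangles \<delta> \<longleftrightarrow> (\<forall>x y z A B C.
     geodesic_segment (realization G) (path_dist G) x y A \<longrightarrow>
     geodesic_segment (realization G) (path_dist G) y z B \<longrightarrow>
     geodesic_segment (realization G) (path_dist G) z x C \<longrightarrow>
     A \<subseteq> neighborhood (realization G) (path_dist G) \<delta> (B \<union> C))"

text \<open>Slimness puts \<open>p i\<close> within \<open>D\<close> of a vertex of one of the other
  two sides. A detour from that vertex to \<open>p i\<close> is paid there and back, hence
  \<open>2 * D\<close>.\<close>

lemma slim_triangle_point:
  assumes \<delta>: "slim_triangles \<delta>"
    and D: "\<delta> + 1 \<le> real D"
    and p: "geodesic_path x z p" and V: "x \<in> verts G" "y \<in> verts G" "z \<in> verts G"
    and i: "i \<le> gd x z"
  shows "near_geodesic (2 * D) x (p i) y \<or> near_geodesic (2 * D) y (p i) z"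
proof -
  obtain q where q: "geodesic_path z y q"
    using geodesic_path_exists V by blast
  obtain r where r: "geodesic_path y x r"
    using geodesic_path_exists V by blast
  have pi: "p i \<in> verts G"
    using p i by (simp add: geodesic_path_def)
  have "Vertex (p i) \<in> realized_path p ` {0..real (gd x z)}"
    using i by (intro image_eqI[of _ _ "real i"]) auto
  then have "Vertex (p i) \<in> neighborhood (realization G) (path_dist G) \<delta>
      (realized_path q ` {0..real (gd z y)} \<union> realized_path r ` {0..real (gd y x)})"
    using \<delta>[unfolded slim_triangles_def, rule_format, OF geodesic_segment_realized_path[OF p]
        geodesic_segment_realized_path[OF q] geodesic_segment_realized_path[OF r]] by blast
  then obtain w where w: "w \<in> realized_path q ` {0..real (gd z y)} \<union> realized_path r ` {0..real (gd y x)}"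
    "path_dist G (Vertex (p i)) w \<le> \<delta>"
    unfolding neighborhood_def by blast
  have near: "near_geodesic (2 * D) a (p i) b"
    if g: "geodesic_path a b g" and V: "a \<in> verts G" "b \<in> verts G"
      and w: "w \<in> realized_path g ` {0..real (gd a b)}" "path_dist G (Vertex (p i)) w \<le> \<delta>"
    for a b g
  proof -
    obtain t where t: "0 \<le> t" "t \<le> real (gd a b)" "w = realized_path g t"
      using w by auto
    obtain j where j: "j \<le> gd a b" "real (gd (p i) (g j)) < \<delta> + 1"
      using near_realized_path[OF g V pi t(1,2)] w t by metis
    have gj: "g j \<in> verts G"
      using g j by (simp add: geodesic_path_def)
    have "gd a (g j) + gd (g j) b = gd a b"
      using geodesic_pathD(5)[OF g, of 0 j] geodesic_pathD(5)[OF g, of j "gd a b"] j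
      by (simp add: geodesic_pathD(1,2)[OF g])
    moreover have "gd a (p i) \<le> gd a (g j) + gd (g j) (p i)" "gd (p i) b \<le> gd (p i) (g j) + gd (g j) b"
      using graph_dist_triangle V gj pi by auto
    moreover have "gd (p i) (g j) \<le> D"
      using j D by linarith
    ultimately show ?thesis
      unfolding near_geodesic_def using graph_dist_sym[of "g j" "p i"] by linarith
  qed
  have "near_geodesic (2 * D) z (p i) y \<or> near_geodesic (2 * D) y (p i) x"
    using near[OF q _ _ _ w(2)] near[OF r _ _ _ w(2)] w(1) V by blast
  then show ?thesis
    unfolding near_geodesic_def using graph_dist_sym by (metis add.commute)
qed

text \<open>Each vertex of the side from \<open>x\<close> to \<open>z\<close> is close to one of the
  other sides. After the last index that is close to the side joining \<open>x\<close> and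
  \<open>y\<close>, the next vertex must be close to the side joining \<open>y\<close> and
  \<open>z\<close>; stepping back along one arc adds at most 2 to the excess.\<close>

lemma slim_triangle_center:
  assumes \<delta>: "slim_triangles \<delta>"
    and D: "\<delta> + 1 \<le> real D"
    and p: "geodesic_path x z p" and V: "x \<in> verts G" "y \<in> verts G" "z \<in> verts G"
  obtains i where "i \<le> gd x z" "near_geodesic (2 * D + 2) x (p i) y" "near_geodesic (2 * D + 2) y (p i) z"
proof -
  note pt = slim_triangle_point[OF \<delta> D p V]
  let ?N = "gd x z"
  have p0: "p 0 = x" "p ?N = z"
    using p by (auto simp: geodesic_path_def)
  define I where "I = {i. i \<le> ?N \<and> near_geodesic (2 * D) x (p i) y}"
  have "finite I" "0 \<in> I"
    using p0 by (auto simp: I_def near_geodesic_def)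
  define i where "i = Max I"
  have iI: "i \<in> I"
    unfolding i_def by (rule Max_in) (use \<open>finite I\<close> \<open>0 \<in> I\<close> in auto)
  show ?thesis
  proof (cases "i = ?N")
    case True
    then show ?thesis
      using iI that[of i] p0 by (auto simp: I_def near_geodesic_def)
  next
    case False
    then have i: "Suc i \<le> ?N"
      using iI by (simp add: I_def)
    have "Suc i \<notin> I"
      using Max_ge[OF \<open>finite I\<close>, of "Suc i"] unfolding i_def by linarith
    then have near: "near_geodesic (2 * D) y (p (Suc i)) z"
      using pt[of "Suc i"] i by (simp add: I_def)
    have v: "p i \<in> verts G" "p (Suc i) \<in> verts G" and "int (gd (p i) (p (Suc i))) = 1"
      using geodesic_pathD(3,5)[OF p] i by simp_all
    then have "gd y (p i) \<le> gd y (p (Suc i)) + 1" "gd (p i) z \<le> gd (p (Suc i)) z + 1"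
      using graph_dist_triangle[of y "p (Suc i)" "p i"] graph_dist_triangle[of "p i" "p (Suc i)" z]
        graph_dist_sym[of "p i" "p (Suc i)"] V by linarith+
    then show ?thesis
      using near iI i that[of i] by (auto simp: I_def near_geodesic_def)
  qed
qed

text \<open>The triangles \<open>x y z\<close> and \<open>x w z\<close> have centers
  \<open>p i\<close> and \<open>p j\<close> on one geodesic from \<open>x\<close> to
  \<open>z\<close>. If \<open>i \<le> j\<close>, the sum \<open>gd x w + gd y z\<close> is the one
  that bounds the left-hand side, otherwise \<open>gd x y + gd z w\<close> is. Each center
  contributes an error \<open>E\<close>.\<close>

lemma hyperbolic_four_point:
  assumes "hyperbolic_graph G"
  obtains C where "\<And>x y z w. x \<in> verts G \<Longrightarrow> y \<in> verts G \<Longrightarrow> z \<in> verts G \<Longrightarrow> w \<in> verts G \<Longrightarrow>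
      gd x z + gd y w \<le> max (gd x y + gd z w) (gd x w + gd y z) + C"
proof -
  obtain \<delta> where h: "\<forall>x y z A B C.
        geodesic_segment (realization G) (path_dist G) x y A \<and>
        geodesic_segment (realization G) (path_dist G) y z B \<and>
        geodesic_segment (realization G) (path_dist G) z x C \<longrightarrow>
        A \<subseteq> neighborhood (realization G) (path_dist G) \<delta> (B \<union> C) \<and>
        B \<subseteq> neighborhood (realization G) (path_dist G) \<delta> (C \<union> A) \<and>
        C \<subseteq> neighborhood (realization G) (path_dist G) \<delta> (A \<union> B)"
    using assms unfolding hyperbolic_graph_def gromov_hyperbolic_def by (elim exE conjE)
  have \<delta>: "slim_triangles \<delta>"
    unfolding slim_triangles_def
  proof (intro allI impI)
    fix x y z A B C
    assume "geodesic_segment (realization G) (path_dist G) x y A"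
      "geodesic_segment (realization G) (path_dist G) y z B"
      "geodesic_segment (realization G) (path_dist G) z x C"
    then show "A \<subseteq> neighborhood (realization G) (path_dist G) \<delta> (B \<union> C)"
      using h[THEN spec, of x, THEN spec, of y, THEN spec, of z, THEN spec, of A, THEN spec, of B,
        THEN spec, of C] by simp
  qed
  obtain D :: nat where D: "\<delta> + 1 \<le> real D"
    using real_arch_simple by blast
  define E where "E = 2 * D + 2"
  have "gd x z + gd y w \<le> max (gd x y + gd z w) (gd x w + gd y z) + 2 * E"
    if V: "x \<in> verts G" "y \<in> verts G" "z \<in> verts G" "w \<in> verts G" for x y z w
  proof -
    obtain p where p: "geodesic_path x z p"
      using geodesic_path_exists V by blast
    let ?N = "gd x z"
    obtain i where i: "i \<le> ?N" "near_geodesic E x (p i) y" "near_geodesic E y (p i) z"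
      using slim_triangle_center[OF \<delta> D p V(1,2,3)] unfolding E_def by blast
    obtain j where j: "j \<le> ?N" "near_geodesic E x (p j) w" "near_geodesic E w (p j) z"
      using slim_triangle_center[OF \<delta> D p V(1,4,3)] unfolding E_def by blast
    have pv: "p i \<in> verts G" "p j \<in> verts G"
      using p i j by (auto simp: geodesic_path_def)
    have e: "gd x (p k) = k \<and> gd (p k) z = ?N - k" if "k \<le> ?N" for k
      using geodesic_pathD(5)[OF p, of 0 k] geodesic_pathD(5)[OF p, of k ?N] that
      by (simp add: geodesic_pathD(1,2)[OF p])
    have ij: "int (gd (p i) (p j)) = \<bar>int i - int j\<bar>"
      using geodesic_pathD(5)[OF p, of i j] i j by simp
    have "gd y w \<le> gd y (p i) + (gd (p i) (p j) + gd (p j) w)"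
      by (meson graph_dist_triangle add_left_mono le_trans V pv)
    then show ?thesis
      using i j e[of i] e[of j] ij unfolding near_geodesic_def
      using graph_dist_sym[of y "p i"] graph_dist_sym[of w "p j"] graph_dist_sym[of z w]
      by linarith
  qed
  then show ?thesis
    by (rule that)
qed

end

section \<open>Hyperbolic bi-invariant norms\<close>

text \<open>The assumption \<open>norm_split\<close> is the algebraic trace of geodesics: a shortest
  word is cut after \<open>k\<close> letters. It provides midpoints.\<close>

locale bi_invariant_norm = group G for G (structure) +
  fixes N :: "'a \<Rightarrow> nat"
  assumes norm_one [simp]: "N \<one> = 0"
    and norm_mult: "x \<in> carrier G \<Longrightarrow> y \<in> carrier G \<Longrightarrow> N (x \<otimes> y) \<le> N x + N y"
    and norm_inv [simp]: "x \<in> carrier G \<Longrightarrow> N (inv x) = N x"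
    and norm_conj: "x \<in> carrier G \<Longrightarrow> y \<in> carrier G \<Longrightarrow> N (y \<otimes> x \<otimes> inv y) = N x"
    and norm_split: "x \<in> carrier G \<Longrightarrow> k \<le> N x \<Longrightarrow>
      \<exists>a\<in>carrier G. \<exists>b\<in>carrier G. x = a \<otimes> b \<and> N a = k \<and> N b = N x - k"

text \<open>The distance behind \<open>four_point\<close> is the left-invariant one,
  \<open>N (inv x \<otimes> y)\<close>.\<close>

locale hyperbolic_bi_invariant_norm = bi_invariant_norm +
  fixes C :: nat
  assumes four_point:
    "x \<in> carrier G \<Longrightarrow> y \<in> carrier G \<Longrightarrow> z \<in> carrier G \<Longrightarrow> w \<in> carrier G \<Longrightarrow>
      N (inv x \<otimes> z) + N (inv y \<otimes> w) \<le>
        max (N (inv x \<otimes> y) + N (inv z \<otimes> w)) (N (inv x \<otimes> w) + N (inv y \<otimes> z)) + C"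
begin

lemma norm_commute:
  assumes "x \<in> carrier G" "y \<in> carrier G"
  shows "N (x \<otimes> y) = N (y \<otimes> x)"
proof -
  have "y \<otimes> (x \<otimes> y) \<otimes> inv y = y \<otimes> x"
    using assms by (simp add: m_assoc)
  then show ?thesis
    using norm_conj[of "x \<otimes> y" y] assms by simp
qed

lemma inv_mult_cancel [simp]:
  "x \<in> carrier G \<Longrightarrow> y \<in> carrier G \<Longrightarrow> inv x \<otimes> (x \<otimes> y) = y"
  "x \<in> carrier G \<Longrightarrow> y \<in> carrier G \<Longrightarrow> x \<otimes> (inv x \<otimes> y) = y"
  by (simp_all add: m_assoc[symmetric])

text \<open>In a hyperbolic group a long \<open>g\<close> may be conjugate to a short element, and
  then its square is hardly longer than \<open>g\<close>. Bi-invariance excludes this: for the two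
  halves of \<open>g = a \<otimes> b\<close>, the products \<open>a \<otimes> b\<close> and
  \<open>b \<otimes> a\<close> have the same norm. The four-point inequality glues such overlapping
  pieces, giving a lower bound first for \<open>b \<otimes> a \<otimes> b\<close> and then for
  \<open>g \<otimes> g\<close>. The additive constant also covers small \<open>N g\<close>, where
  the other alternative of a maximum can occur.\<close>

lemma norm_square:
  assumes g: "g \<in> carrier G"
  shows "2 * N g \<le> N (g \<otimes> g) + (4 * C + 2)"
proof -
  define m where "m = N g div 2"
  obtain a b where a: "a \<in> carrier G" and b: "b \<in> carrier G" and ab: "g = a \<otimes> b"
    and Na: "N a = m" and Nb: "N b = N g - m"
    using norm_split[OF g, of m] by (auto simp: m_def)
  have Nba: "N (b \<otimes> a) = N g"
    using norm_commute[OF a b] ab by simp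
  have Nab: "N (a \<otimes> b) = N g"
    using ab by simp
  have gg: "g \<otimes> g = a \<otimes> (b \<otimes> (a \<otimes> b))"
    using ab a b by (simp add: m_assoc)
  have "N g + N g \<le> max (N a + N a) (N (a \<otimes> b \<otimes> a) + N b) + C"
    using four_point[of \<one> a "a \<otimes> b" "a \<otimes> b \<otimes> a"] a b Nab Nba by (simp add: m_assoc inv_mult_group)
  moreover have "N g + N g \<le> max (N b + N b) (N (b \<otimes> a \<otimes> b) + N a) + C"
    using four_point[of \<one> b "b \<otimes> a" "b \<otimes> a \<otimes> b"] a b Nab Nba
    by (simp add: m_assoc inv_mult_group)
  moreover have "N g + N (b \<otimes> a \<otimes> b) \<le> max (N a + N g) (N (g \<otimes> g) + N b) + C"
    using four_point[of \<one> a "a \<otimes> b" "a \<otimes> b \<otimes> a \<otimes> b"] a b Nab Nba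
    by (simp add: m_assoc inv_mult_group gg)
  moreover have "m + N b = N g" "m \<le> N b" "N b \<le> m + 1"
    unfolding Nb m_def by linarith+
  ultimately show ?thesis
    unfolding Na by linarith
qed

text \<open>
  Unless \<open>g h\<close> or \<open>g\<^sup>-\<^sup>1 h\<close> is longer than \<open>g\<close> by about \<open>N g\<close>, both \<open>g\<close> and \<open>g h\<close> are midpoints of
  \<open>1\<close> and \<open>g\<^sup>2\<close> although they are at distance \<open>N h\<close>.
\<close>
lemma norm_mult_or_inv_mult_bounded:
  assumes g: "g \<in> carrier G" and h: "h \<in> carrier G" and E: "N g \<le> N h + E" "N h \<le> N g + E"
  shows "N (g \<otimes> h) \<le> 6 * C + 3 * E + 2 \<or> N (inv g \<otimes> h) \<le> 6 * C + 3 * E + 2"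
proof -
  have c: "N (inv h \<otimes> (g \<otimes> h)) = N g"
    using norm_conj[of g "inv h"] g h by (simp add: m_assoc)
  have "N (g \<otimes> g) + N h \<le> max (N g + N (inv g \<otimes> h)) (N (g \<otimes> h) + N g) + C"
    using four_point[of \<one> g "g \<otimes> g" "g \<otimes> h"] g h by (simp add: m_assoc inv_mult_group)
  \<comment> \<open>In the quadrilateral \<open>1, g, g h, h\<close> opposite sides have equal
    length by conjugation invariance. Its two diagonals together measure about
    \<open>2 * N g\<close> at most, while the previous inequality makes one of them about that
    long.\<close>
  moreover have "N (g \<otimes> h) + N (inv g \<otimes> h) \<le> max (N g + N g) (N h + N h) + C"
    using four_point[of \<one> g "g \<otimes> h" h] g h c norm_inv[of "inv h \<otimes> (g \<otimes> h)"]
    by (simp add: m_assoc inv_mult_group)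
  ultimately show ?thesis
    using norm_square[OF g] E by linarith
qed

end

section \<open>Conjugation-invariant word norms\<close>

definition quasimorphism :: "('a, 'm) monoid_scheme \<Rightarrow> nat \<Rightarrow> ('a \<Rightarrow> int) \<Rightarrow> bool" where
  "quasimorphism G D \<phi> \<longleftrightarrow> \<phi> \<one>\<^bsub>G\<^esub> = 0 \<and>
     (\<forall>x\<in>carrier G. \<forall>y\<in>carrier G. \<bar>\<phi> (x \<otimes>\<^bsub>G\<^esub> y) - \<phi> x - \<phi> y\<bar> \<le> int D)"

locale normal_generating_set = group G for G (structure) +
  fixes S :: "'a set"
  assumes S_carrier: "S \<subseteq> carrier G"
    and S_inv: "s \<in> S \<Longrightarrow> inv s \<in> S"
    and S_conj: "s \<in> S \<Longrightarrow> x \<in> carrier G \<Longrightarrow> x \<otimes> s \<otimes> inv x \<in> S"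
    and S_generate: "generate G S = carrier G"
begin

abbreviation \<Gamma> :: "('a, 'a \<times> 'a) pre_digraph" where
  "\<Gamma> \<equiv> cayley_graph G S"

lemma arcs_ends_cayley_graph: "arcs_ends \<Gamma> = {(v, v \<otimes> s) | v s. v \<in> carrier G \<and> s \<in> S}"
  by (auto simp: arcs_ends_conv cayley_graph_def image_iff)

lemma symmetric_cayley_graph: "(u, v) \<in> arcs_ends \<Gamma> \<Longrightarrow> (v, u) \<in> arcs_ends \<Gamma>"
proof -
  assume "(u, v) \<in> arcs_ends \<Gamma>"
  then obtain s where s: "u \<in> carrier G" "s \<in> S" "v = u \<otimes> s"
    by (auto simp: arcs_ends_cayley_graph)
  then have "u = v \<otimes> inv s" "v \<in> carrier G" "inv s \<in> S"
    using S_carrier S_inv by (auto simp: m_assoc)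
  then show ?thesis
    by (auto simp: arcs_ends_cayley_graph)
qed

lemma joined_by_walk_Suc:
  "joined_by_walk \<Gamma> (Suc k) u v \<longleftrightarrow>
     (\<exists>w s. joined_by_walk \<Gamma> k u w \<and> w \<in> carrier G \<and> s \<in> S \<and> v = w \<otimes> s)"
proof -
  have "arcs_ends \<Gamma> \<union> (arcs_ends \<Gamma>)\<inverse> = arcs_ends \<Gamma>"
    using symmetric_cayley_graph by auto
  then show ?thesis
    by (auto simp: joined_by_walk_def arcs_ends_cayley_graph relcomp_unfold)
qed

lemma joined_by_walk_translate:
  "joined_by_walk \<Gamma> k u v \<Longrightarrow> u \<in> carrier G \<Longrightarrow> x \<in> carrier G \<Longrightarrow> joined_by_walk \<Gamma> k (x \<otimes> u) (x \<otimes> v)"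
proof (induction k arbitrary: v)
  case (Suc k)
  then obtain w s where "joined_by_walk \<Gamma> k u w" "w \<in> carrier G" "s \<in> S" "v = w \<otimes> s"
    by (auto simp: joined_by_walk_Suc)
  moreover have "x \<otimes> (w \<otimes> s) = x \<otimes> w \<otimes> s"
    using calculation S_carrier Suc.prems by (subst m_assoc) auto
  ultimately show ?case
    using Suc by (auto simp: joined_by_walk_Suc)
qed simp

text \<open>Left translations are automorphisms of any Cayley graph; conjugations are automorphisms
  of this one because they permute the generators.\<close>

lemma joined_by_walk_conj:
  "joined_by_walk \<Gamma> k u v \<Longrightarrow> u \<in> carrier G \<Longrightarrow> x \<in> carrier G \<Longrightarrow>
     joined_by_walk \<Gamma> k (x \<otimes> u \<otimes> inv x) (x \<otimes> v \<otimes> inv x)"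
proof (induction k arbitrary: v)
  case (Suc k)
  then obtain w s where w: "joined_by_walk \<Gamma> k u w" "w \<in> carrier G" "s \<in> S" "v = w \<otimes> s"
    by (auto simp: joined_by_walk_Suc)
  have "s \<in> carrier G"
    using w S_carrier by auto
  then have "x \<otimes> v \<otimes> inv x = (x \<otimes> w \<otimes> inv x) \<otimes> (x \<otimes> s \<otimes> inv x)"
    using w Suc.prems by (simp add: m_assoc) (simp add: m_assoc[symmetric])
  then show ?case
    using Suc.IH[OF w(1)] Suc.prems w S_conj[of s x]
    unfolding joined_by_walk_Suc by blast
qed simp

lemma joined_by_walk_one:
  assumes "v \<in> carrier G"
  shows "\<exists>k. joined_by_walk \<Gamma> k \<one> v"
proof -
  have step: "joined_by_walk \<Gamma> 1 \<one> s" if "s \<in> S" for s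
    using that S_carrier by (auto simp: joined_by_walk_Suc intro!: exI[of _ s])
  have "v \<in> generate G S"
    using assms by (simp add: S_generate)
  then show ?thesis
  proof induction
    case one
    show ?case
      by (rule exI[of _ 0]) simp
  next
    case (incl s)
    then show ?case
      using step by blast
  next
    case (inv s)
    then show ?case
      using step S_inv by blast
  next
    case (eng x y)
    then obtain k l where k: "joined_by_walk \<Gamma> k \<one> x" and l: "joined_by_walk \<Gamma> l \<one> y"
      by blast
    have "x \<in> carrier G"
      using eng S_generate by auto
    then have "joined_by_walk \<Gamma> l x (x \<otimes> y)"
      using joined_by_walk_translate[OF l one_closed, of x] by simp
    then show ?case
      using joined_by_walk_trans[OF k] by blast
  qed
qed

sublocale cayley: connected_sym_digraph \<Gamma>
proof
  show "tail \<Gamma> e \<in> verts \<Gamma>" "head \<Gamma> e \<in> verts \<Gamma>" if "e \<in> arcs \<Gamma>" for e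
    using that S_carrier by (auto simp: cayley_graph_def)
  show "symmetric \<Gamma>"
    unfolding symmetric_def using symmetric_cayley_graph by (auto intro: symI)
  fix u v assume "u \<in> verts \<Gamma>" "v \<in> verts \<Gamma>"
  then have uv: "u \<in> carrier G" "v \<in> carrier G"
    by (auto simp: cayley_graph_def)
  then obtain k where "joined_by_walk \<Gamma> k \<one> (inv u \<otimes> v)"
    using joined_by_walk_one by blast
  then have "joined_by_walk \<Gamma> k (u \<otimes> \<one>) (u \<otimes> (inv u \<otimes> v))"
    using uv by (intro joined_by_walk_translate) auto
  then show "\<exists>k. joined_by_walk \<Gamma> k u v"
    using uv by (auto simp: m_assoc[symmetric])
qed

lemma verts_cayley_graph [simp]: "verts \<Gamma> = carrier G"
  by (simp add: cayley_graph_def)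

section \<open>Bi-invariance of the word norm\<close>

abbreviation word_norm :: "'a \<Rightarrow> nat" where
  "word_norm \<equiv> graph_dist \<Gamma> \<one>"

lemma graph_dist_translate:
  assumes "x \<in> carrier G" "u \<in> carrier G" "v \<in> carrier G"
  shows "graph_dist \<Gamma> (x \<otimes> u) (x \<otimes> v) = graph_dist \<Gamma> u v"
proof -
  have le: "graph_dist \<Gamma> (x \<otimes> u) (x \<otimes> v) \<le> graph_dist \<Gamma> u v"
    if "x \<in> carrier G" "u \<in> carrier G" "v \<in> carrier G" for x u v
    using that by (intro cayley.graph_dist_le joined_by_walk_translate cayley.joined_by_walk_graph_dist) auto
  show ?thesis
    using le[OF assms] le[of "inv x" "x \<otimes> u" "x \<otimes> v"] assms by (simp add: m_assoc[symmetric])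
qed

lemma graph_dist_word_norm:
  "u \<in> carrier G \<Longrightarrow> v \<in> carrier G \<Longrightarrow> graph_dist \<Gamma> u v = word_norm (inv u \<otimes> v)"
  using graph_dist_translate[of "inv u" u v] by simp

sublocale bi_invariant_norm G word_norm
proof
  fix x y assume x: "x \<in> carrier G" and y: "y \<in> carrier G"
  show "word_norm (x \<otimes> y) \<le> word_norm x + word_norm y"
    using cayley.graph_dist_triangle[of \<one> x "x \<otimes> y"] graph_dist_translate[of x \<one> y] x y by simp
  show "word_norm (inv x) = word_norm x"
    using graph_dist_translate[of "inv x" x \<one>] cayley.graph_dist_sym[of x \<one>] x by simp
  have le: "word_norm (y \<otimes> x \<otimes> inv y) \<le> word_norm x" if "x \<in> carrier G" "y \<in> carrier G" for x y
    using joined_by_walk_conj[OF cayley.joined_by_walk_graph_dist[of \<one> x], of y] that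
    by (intro cayley.graph_dist_le) simp
  have "inv y \<otimes> (y \<otimes> x \<otimes> inv y) \<otimes> inv (inv y) = x"
    using x y by (simp add: m_assoc) (simp add: m_assoc[symmetric])
  then show "word_norm (y \<otimes> x \<otimes> inv y) = word_norm x"
    using le[OF x y] le[of "y \<otimes> x \<otimes> inv y" "inv y"] x y by simp
next
  fix x k assume x: "x \<in> carrier G" and k: "k \<le> word_norm x"
  obtain p where p: "cayley.geodesic_path \<one> x p"
    using cayley.geodesic_path_exists[of \<one> x] x by auto
  have pk: "p k \<in> carrier G"
    using cayley.geodesic_pathD(3)[OF p k] by simp
  have "word_norm (p k) = k" "graph_dist \<Gamma> (p k) x = word_norm x - k"
    using cayley.geodesic_pathD(5)[OF p, of 0 k] cayley.geodesic_pathD(5)[OF p, of k "word_norm x"] k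
    by (simp_all add: cayley.geodesic_pathD(1,2)[OF p])
  moreover have "x = p k \<otimes> (inv (p k) \<otimes> x)"
    using pk x by (simp add: m_assoc[symmetric])
  ultimately show "\<exists>a\<in>carrier G. \<exists>b\<in>carrier G. x = a \<otimes> b \<and> word_norm a = k \<and> word_norm b = word_norm x - k"
    using pk x graph_dist_word_norm[OF pk x] by (intro bexI[of _ "p k"] bexI[of _ "inv (p k) \<otimes> x"]) auto
qed simp

text \<open>Appending one generator changes \<open>\<phi>\<close> by at most
  \<open>A + D\<close>.\<close>

lemma quasimorphism_le_word_norm:
  assumes \<phi>: "quasimorphism G D \<phi>" and A: "\<And>s. s \<in> S \<Longrightarrow> \<bar>\<phi> s\<bar> \<le> int A" and x: "x \<in> carrier G"
  shows "\<bar>\<phi> x\<bar> \<le> int (word_norm x * (A + D))"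
proof -
  have "\<bar>\<phi> v\<bar> \<le> int (k * (A + D))" if "joined_by_walk \<Gamma> k \<one> v" for k v
    using that
  proof (induction k arbitrary: v)
    case 0
    then show ?case
      using \<phi> by (simp add: quasimorphism_def)
  next
    case (Suc k)
    then obtain w s where w: "joined_by_walk \<Gamma> k \<one> w" "w \<in> carrier G" "s \<in> S" "v = w \<otimes> s"
      by (auto simp: joined_by_walk_Suc)
    have "\<bar>\<phi> (w \<otimes> s) - \<phi> w - \<phi> s\<bar> \<le> int D"
      using \<phi> w S_carrier unfolding quasimorphism_def by blast
    moreover have "int (Suc k * (A + D)) = int (k * (A + D)) + int A + int D"
      by simp
    ultimately show ?case
      using Suc.IH[OF w(1)] A[OF w(3)] unfolding w(4) by linarith
  qed
  then show ?thesis
    using cayley.joined_by_walk_graph_dist[of \<one> x] x by simp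
qed

text \<open>The growth of \<open>\<psi>\<close> forces the powers of \<open>b\<close> to have
  unbounded norm, so some power \<open>h\<close> of \<open>b\<close> nearly matches the norm of a
  high power \<open>g\<close> of \<open>a\<close>. Hyperbolicity bounds the norm of
  \<open>g \<otimes> h\<close> or \<open>inv g \<otimes> h\<close>, hence also the value of
  \<open>\<phi>\<close> there. But \<open>\<phi>\<close> is bounded at \<open>h\<close> and
  arbitrarily large at \<open>g\<close>.\<close>

lemma not_hyperbolic_if_quasimorphisms:
  assumes \<phi>: "quasimorphism G D \<phi>" and \<psi>: "quasimorphism G D \<psi>"
    and \<phi>S: "\<And>s. s \<in> S \<Longrightarrow> \<bar>\<phi> s\<bar> \<le> int A" and \<psi>S: "\<And>s. s \<in> S \<Longrightarrow> \<bar>\<psi> s\<bar> \<le> int A"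
    and a: "a \<in> carrier G" and b: "b \<in> carrier G"
    and \<phi>a: "\<And>k::nat. int k \<le> \<phi> (a [^] k)" and \<phi>b: "\<And>k::nat. \<bar>\<phi> (b [^] k)\<bar> \<le> int E"
    and \<psi>b: "\<And>k::nat. int k \<le> \<psi> (b [^] k)"
  shows "\<not> hyperbolic_graph \<Gamma>"
proof
  assume "hyperbolic_graph \<Gamma>"
  then obtain C where C: "\<And>x y z w. x \<in> carrier G \<Longrightarrow> y \<in> carrier G \<Longrightarrow> z \<in> carrier G \<Longrightarrow> w \<in> carrier G \<Longrightarrow>
      graph_dist \<Gamma> x z + graph_dist \<Gamma> y w \<le>
        max (graph_dist \<Gamma> x y + graph_dist \<Gamma> z w) (graph_dist \<Gamma> x w + graph_dist \<Gamma> y z) + C"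
    using cayley.hyperbolic_four_point by auto
  interpret hyperbolic_bi_invariant_norm G word_norm C
    using C by unfold_locales (simp flip: graph_dist_word_norm)
  define K where "K = A + D"
  define B where "B = 6 * C + 3 * word_norm b + 2"
  \<comment> \<open>\<open>B\<close> depends on \<open>C\<close> and \<open>b\<close> but not on
    \<open>g\<close>, so \<open>k\<close> can be chosen after it. \<open>B * K\<close> bounds
    \<open>\<phi>\<close> on elements of norm at most \<open>B\<close>, \<open>E\<close> bounds it
    on powers of \<open>b\<close>, and one defect \<open>D\<close> each is paid for inverting
    \<open>g\<close> and for multiplying by \<open>h\<close>.\<close>
  define k where "k = B * K + E + 2 * D + 1"
  define g where "g = a [^] k"
  have g: "g \<in> carrier G"
    using a by (simp add: g_def)
  \<comment> \<open>The first power of \<open>b\<close> that reaches the norm of \<open>g\<close>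
    overshoots it by at most the norm of \<open>b\<close>.\<close>
  define l where "l = (LEAST l::nat. word_norm g \<le> word_norm (b [^] l))"
  define h where "h = b [^] l"
  have h: "h \<in> carrier G"
    using b by (simp add: h_def)
  have "word_norm g \<le> word_norm (b [^] (word_norm g * K + 1))"
  proof (rule ccontr)
    let ?l = "word_norm g * K + 1"
    assume "\<not> ?thesis"
    then have "word_norm (b [^] ?l) * K \<le> word_norm g * K"
      by (intro mult_le_mono1) simp
    moreover have "int ?l \<le> int (word_norm (b [^] ?l) * K)"
      using quasimorphism_le_word_norm[OF \<psi> \<psi>S, of "b [^] ?l"] \<psi>b[of ?l] b
      unfolding K_def by fastforce
    ultimately show False
      by linarith
  qed
  then have l: "word_norm g \<le> word_norm h"
    unfolding h_def l_def by (rule LeastI)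
  have "word_norm h \<le> word_norm g + word_norm b"
  proof (cases l)
    case 0
    then show ?thesis
      by (simp add: h_def)
  next
    case (Suc m)
    then have "\<not> word_norm g \<le> word_norm (b [^] m)"
      using not_less_Least[of m "\<lambda>l. word_norm g \<le> word_norm (b [^] l)"] unfolding l_def by simp
    moreover have "word_norm h \<le> word_norm (b [^] m) + word_norm b"
      unfolding h_def Suc using norm_mult[of "b [^] m" b] b by simp
    ultimately show ?thesis
      by simp
  qed
  then have "word_norm (g \<otimes> h) \<le> B \<or> word_norm (inv g \<otimes> h) \<le> B"
    unfolding B_def using norm_mult_or_inv_mult_bounded[OF g h, of "word_norm b"] l by simp
  then obtain e where e: "e = g \<or> e = inv g" and "word_norm (e \<otimes> h) \<le> B"
    by blast
  then have "word_norm (e \<otimes> h) * K \<le> B * K"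
    by simp
  moreover have ec: "e \<in> carrier G"
    using e g by auto
  ultimately have eh: "\<bar>\<phi> (e \<otimes> h)\<bar> \<le> int (B * K)"
    using quasimorphism_le_word_norm[OF \<phi> \<phi>S, of "e \<otimes> h"] h unfolding K_def by (smt (verit) m_closed of_nat_le_iff)
  have \<phi>1: "\<phi> \<one> = 0" and D: "\<And>x y. x \<in> carrier G \<Longrightarrow> y \<in> carrier G \<Longrightarrow> \<bar>\<phi> (x \<otimes> y) - \<phi> x - \<phi> y\<bar> \<le> int D"
    using \<phi> by (auto simp: quasimorphism_def)
  have "int k \<le> \<bar>\<phi> e\<bar> + int D"
    using e D[of g "inv g"] g \<phi>1 \<phi>a[of k] unfolding g_def[symmetric] by auto
  then show False
    using D[OF ec h] eh \<phi>b[of l] unfolding h_def[symmetric] k_def by linarith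
qed

end

section \<open>Reduced words in free groups\<close>

fun inv_letter :: "'a \<times> bool \<Rightarrow> 'a \<times> bool" where
  "inv_letter (b, e) = (b, \<not> e)"

definition inv_word :: "('a \<times> bool) list \<Rightarrow> ('a \<times> bool) list" where
  "inv_word w = rev (map inv_letter w)"

lemma inv_letter_inv_letter [simp]: "inv_letter (inv_letter x) = x"
  by (cases x) simp

lemma inv_letter_eq_iff [simp]: "inv_letter x = inv_letter y \<longleftrightarrow> x = y"
  by (metis inv_letter_inv_letter)

lemma inv_letter_neq [simp]: "inv_letter x \<noteq> x" "x \<noteq> inv_letter x"
  by (cases x; simp)+

lemma inv_letter_mem_iff [simp]: "inv_letter x \<in> B \<times> UNIV \<longleftrightarrow> x \<in> B \<times> UNIV"
  by (cases x) simp

lemma inv_word_Nil [simp]: "inv_word [] = []"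
  by (simp add: inv_word_def)

lemma inv_word_Cons [simp]: "inv_word (x # w) = inv_word w @ [inv_letter x]"
  by (simp add: inv_word_def)

lemma inv_word_append [simp]: "inv_word (u @ v) = inv_word v @ inv_word u"
  by (simp add: inv_word_def)

lemma inv_word_inv_word [simp]: "inv_word (inv_word w) = w"
  by (induction w) auto

lemma length_inv_word [simp]: "length (inv_word w) = length w"
  by (simp add: inv_word_def)

lemma inv_word_eq_Nil_iff [simp]: "inv_word w = [] \<longleftrightarrow> w = []"
  by (simp add: inv_word_def)

lemma set_inv_word: "set (inv_word w) = inv_letter ` set w"
  by (simp add: inv_word_def)

lemma set_inv_word_subset_iff [simp]: "set (inv_word w) \<subseteq> B \<times> UNIV \<longleftrightarrow> set w \<subseteq> B \<times> UNIV"
  by (force simp: set_inv_word)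

lemma reduced_word_altdef: "reduced_word w \<longleftrightarrow> successively (\<lambda>x y. y \<noteq> inv_letter x) w"
  unfolding reduced_word_def by (rule arg_cong[where f = "\<lambda>P. successively P w"]) (auto simp: fun_eq_iff)

lemma reduced_word_Nil [simp]: "reduced_word []"
  by (simp add: reduced_word_def)

lemma reduced_word_append:
  "reduced_word (u @ v) \<longleftrightarrow>
     reduced_word u \<and> reduced_word v \<and> (u = [] \<or> v = [] \<or> hd v \<noteq> inv_letter (last u))"
  unfolding reduced_word_altdef by (auto simp: successively_append_iff)

lemma reduced_word_Cons:
  "reduced_word (x # v) \<longleftrightarrow> reduced_word v \<and> (v = [] \<or> hd v \<noteq> inv_letter x)"
  unfolding reduced_word_altdef by (auto simp: successively_Cons)

lemma reduced_inv_word [simp]: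
  fixes w :: "('a \<times> bool) list"
  shows "reduced_word (inv_word w) \<longleftrightarrow> reduced_word w"
proof -
  have "reduced_word (inv_word w) \<longleftrightarrow> successively (\<lambda>x y. x \<noteq> inv_letter y) w"
    unfolding reduced_word_altdef inv_word_def by (simp add: successively_map)
  also have "\<dots> \<longleftrightarrow> reduced_word w"
    unfolding reduced_word_altdef by (rule successively_cong) (metis inv_letter_inv_letter, simp)
  finally show ?thesis .
qed

text \<open>Cancellation happens in a single block \<open>z\<close> at the junction: letters are
  removed from the end of \<open>u\<close> as long as they meet their inverses at the front of
  \<open>v\<close>.\<close>

lemma reduced_word_cancel:
  assumes "reduced_word u" "reduced_word v"
  obtains u' z v' where "u = u' @ z" "v = inv_word z @ v'" "reduced_word (u' @ v')"
  using assms
proof (induction u arbitrary: v thesis rule: rev_induct)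
  case Nil
  then show ?case
    by (metis append_Nil inv_word_Nil)
next
  case (snoc x u)
  show ?case
  proof (cases "reduced_word ((u @ [x]) @ v)")
    case True
    then show ?thesis
      using snoc.prems(1)[of "u @ [x]" "[]" v] by simp
  next
    case False
    then have v: "v \<noteq> []" "hd v = inv_letter x"
      using snoc.prems(2,3) False reduced_word_append[of "u @ [x]" v] by auto
    then obtain v1 where v1: "v = inv_letter x # v1"
      by (cases v) auto
    have "reduced_word u" "reduced_word v1"
      using snoc.prems(2,3) v1 by (auto simp: reduced_word_append reduced_word_Cons)
    then obtain u' z v' where "u = u' @ z" "v1 = inv_word z @ v'" "reduced_word (u' @ v')"
      using snoc.IH by blast
    then show ?thesis
      using snoc.prems(1)[of u' "z @ [x]" v'] v1 by simp
  qed
qed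

text \<open>A word that cancels against itself begins with the inverse of its last letter; both are
  stripped and the induction continues inside. Such a word is not a single letter, since no letter
  is its own inverse.\<close>

lemma cyclic_reduction:
  assumes "reduced_word w"
  obtains y u where "w = y @ u @ inv_word y" "reduced_word (u @ u)"
  using assms
proof (induction "length w" arbitrary: w thesis rule: less_induct)
  case less
  show ?case
  proof (cases "reduced_word (w @ w)")
    case True
    then show ?thesis
      using less.prems(1)[of "[]" w] by simp
  next
    case False
    then have w: "w \<noteq> []" "hd w = inv_letter (last w)"
      using less.prems(2) False reduced_word_append[of w w] by auto
    then obtain x w1 where x: "w = x # w1"
      by (cases w) auto
    have "w1 \<noteq> []"
      using w x by (auto split: if_splits)
    then obtain w2 where w2: "w1 = w2 @ [inv_letter x]"
      using w x by (metis append_butlast_last_id inv_letter_inv_letter last_ConsR list.sel(1))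
    have "reduced_word w2"
      using less.prems(2) x w2 by (auto simp: reduced_word_append reduced_word_Cons)
    then obtain y u where "w2 = y @ u @ inv_word y" "reduced_word (u @ u)"
      using less.hyps[of w2] x w2 by auto
    then show ?thesis
      using less.prems(1)[of "x # y" u] x w2 by simp
  qed
qed

locale free_group_basis = group G for G (structure) +
  fixes B :: "'a set"
  assumes basis: "free_basis G B"
begin

lemma basis_carrier: "B \<subseteq> carrier G"
  and generate_basis: "generate G B = carrier G"
  and reduced_word_value: "w \<noteq> [] \<Longrightarrow> set w \<subseteq> B \<times> UNIV \<Longrightarrow> reduced_word w \<Longrightarrow> word_value G w \<noteq> \<one>"
  using basis unfolding free_basis_def by blast+

end

section \<open>Existence and uniqueness of reduced forms, and the form of a product\<close>

context group
begin

lemma word_value_Nil [simp]: "word_value G [] = \<one>"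
  by (simp add: word_value_def)

lemma word_value_Cons [simp]:
  "word_value G (x # w) = (if snd x then fst x else inv (fst x)) \<otimes> word_value G w"
  by (simp add: word_value_def split: prod.split)

lemma word_value_closed [simp]: "set w \<subseteq> carrier G \<times> UNIV \<Longrightarrow> word_value G w \<in> carrier G"
  by (induction w) auto

lemma word_value_append:
  "set u \<subseteq> carrier G \<times> UNIV \<Longrightarrow> set v \<subseteq> carrier G \<times> UNIV \<Longrightarrow>
     word_value G (u @ v) = word_value G u \<otimes> word_value G v"
  by (induction u) (auto simp: m_assoc)

lemma word_value_inv_word:
  "set w \<subseteq> carrier G \<times> UNIV \<Longrightarrow> word_value G (inv_word w) = inv (word_value G w)"
proof (induction w)
  case (Cons x w)
  then have w: "set (inv_word w) \<subseteq> carrier G \<times> UNIV" "set w \<subseteq> carrier G \<times> UNIV" "fst x \<in> carrier G"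
    by auto
  then have "word_value G (inv_word (x # w)) =
      inv (word_value G w) \<otimes> word_value G [inv_letter x]"
    using Cons.IH by (cases x) (subst inv_word_Cons, subst word_value_append, auto)
  then show ?case
    using w by (cases x) (auto simp: inv_mult_group)
qed simp

lemma reduced_word_exists:
  assumes "B \<subseteq> carrier G" and "g \<in> generate G B"
  obtains w where "set w \<subseteq> B \<times> UNIV" "reduced_word w" "word_value G w = g"
proof -
  from assms(2) have "\<exists>w. set w \<subseteq> B \<times> UNIV \<and> reduced_word w \<and> word_value G w = g"
  proof induction
    case one
    show ?case
      by (rule exI[of _ "[]"]) simp
  next
    case (incl h)
    then show ?case
      using assms(1) by (intro exI[of _ "[(h, True)]"]) (auto simp: reduced_word_Cons)
  next
    case (inv h)
    then show ?case
      using assms(1) by (intro exI[of _ "[(h, False)]"]) (auto simp: reduced_word_Cons)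
  next
    case (eng g h)
    then obtain u v where u: "set u \<subseteq> B \<times> UNIV" "reduced_word u" "word_value G u = g"
      and v: "set v \<subseteq> B \<times> UNIV" "reduced_word v" "word_value G v = h"
      by blast
    obtain u' z v' where z: "u = u' @ z" "v = inv_word z @ v'" "reduced_word (u' @ v')"
      using reduced_word_cancel[OF u(2) v(2)] by blast
    have s: "set u' \<subseteq> B \<times> UNIV" "set z \<subseteq> B \<times> UNIV" "set v' \<subseteq> B \<times> UNIV"
      using u v z by auto
    then have c: "set u' \<subseteq> carrier G \<times> UNIV" "set z \<subseteq> carrier G \<times> UNIV" "set v' \<subseteq> carrier G \<times> UNIV"
      using assms(1) by blast+
    have "g \<otimes> h = word_value G u' \<otimes> word_value G z \<otimes> (inv (word_value G z) \<otimes> word_value G v')"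
      using u v z c by (simp add: word_value_append word_value_inv_word)
    also have "\<dots> = word_value G (u' @ v')"
      using c by (simp add: word_value_append m_assoc) (simp add: m_assoc[symmetric])
    finally show ?case
      using z s by (intro exI[of _ "u' @ v'"]) auto
  qed
  then show ?thesis
    using that by blast
qed

end

context free_group_basis
begin

lemma words_carrier: "set w \<subseteq> B \<times> UNIV \<Longrightarrow> set w \<subseteq> carrier G \<times> UNIV"
  using basis_carrier by blast

definition reduced_form :: "'a \<Rightarrow> ('a \<times> bool) list \<Rightarrow> bool" where
  "reduced_form g w \<longleftrightarrow> set w \<subseteq> B \<times> UNIV \<and> reduced_word w \<and> word_value G w = g"

text \<open>After cancelling \<open>u\<close> against the inverse of \<open>v\<close>, what survives
  is a reduced word of value one, hence empty; both words equal the cancelled block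
  \<open>z\<close>.\<close>

lemma reduced_form_unique:
  assumes "reduced_form g u" "reduced_form g v"
  shows "u = v"
proof -
  have uv: "set u \<subseteq> B \<times> UNIV" "reduced_word u" "set v \<subseteq> B \<times> UNIV" "reduced_word v"
    "word_value G u = word_value G v"
    using assms by (auto simp: reduced_form_def)
  obtain u' z v' where z: "u = u' @ z" "inv_word v = inv_word z @ v'" "reduced_word (u' @ v')"
    using reduced_word_cancel[of u "inv_word v"] uv by auto
  have v: "v = inv_word v' @ z"
    using z(2) by (metis inv_word_append inv_word_inv_word)
  have s: "set u' \<subseteq> B \<times> UNIV" "set z \<subseteq> B \<times> UNIV" "set v' \<subseteq> B \<times> UNIV"
    using uv z(1) v by auto
  note c = s[THEN words_carrier]
  have "word_value G u' \<otimes> word_value G z = inv (word_value G v') \<otimes> word_value G z"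
    using uv(5) z(1) v c by (simp add: word_value_append word_value_inv_word)
  then have "word_value G u' = inv (word_value G v')"
    using c by simp
  then have "word_value G (u' @ v') = \<one>"
    using c by (simp add: word_value_append)
  then have "u' @ v' = []"
    using reduced_word_value[of "u' @ v'"] s z(3) by auto
  then show ?thesis
    using z v by simp
qed

definition nf :: "'a \<Rightarrow> ('a \<times> bool) list" where
  "nf g = (THE w. reduced_form g w)"

lemma reduced_form_nf:
  assumes "g \<in> carrier G"
  shows "reduced_form g (nf g)"
proof -
  obtain w where "set w \<subseteq> B \<times> UNIV" "reduced_word w" "word_value G w = g"
    using reduced_word_exists[OF basis_carrier, of g] assms generate_basis by auto
  then have "reduced_form g w"
    by (simp add: reduced_form_def)
  then show ?thesis
    unfolding nf_def by (rule theI) (auto intro: reduced_form_unique simp: \<open>reduced_form g w\<close>)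
qed

lemma
  assumes "g \<in> carrier G"
  shows set_nf: "set (nf g) \<subseteq> B \<times> UNIV"
    and reduced_nf: "reduced_word (nf g)"
    and word_value_nf: "word_value G (nf g) = g"
  using reduced_form_nf[OF assms] by (auto simp: reduced_form_def)

lemma nf_eqI: "set w \<subseteq> B \<times> UNIV \<Longrightarrow> reduced_word w \<Longrightarrow> word_value G w = g \<Longrightarrow> nf g = w"
  using reduced_form_unique[OF reduced_form_nf, of g w] words_carrier[of w]
  by (auto simp: reduced_form_def)

lemma nf_one [simp]: "nf \<one> = []"
  by (rule nf_eqI) auto

text \<open>Geodesic triangles in the Cayley tree are tripods; \<open>u\<close>, \<open>z\<close>
  and \<open>v\<close> label the three legs of the one spanned by \<open>1\<close>, \<open>g\<close>
  and \<open>g \<otimes> h\<close>.\<close>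

lemma nf_mult:
  assumes g: "g \<in> carrier G" and h: "h \<in> carrier G"
  obtains u z v where "nf g = u @ z" "nf h = inv_word z @ v" "nf (g \<otimes> h) = u @ v"
proof -
  obtain u z v where z: "nf g = u @ z" "nf h = inv_word z @ v" "reduced_word (u @ v)"
    using reduced_word_cancel[OF reduced_nf[OF g] reduced_nf[OF h]] by blast
  have s: "set u \<subseteq> B \<times> UNIV" "set z \<subseteq> B \<times> UNIV" "set v \<subseteq> B \<times> UNIV"
    using set_nf[OF g] set_nf[OF h] z by auto
  note c = s[THEN words_carrier]
  have "g \<otimes> h = word_value G (u @ z) \<otimes> word_value G (inv_word z @ v)"
    using word_value_nf[OF g] word_value_nf[OF h] z by simp
  also have "\<dots> = word_value G (u @ v)"
    using c by (simp add: word_value_append word_value_inv_word m_assoc) (simp add: m_assoc[symmetric])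
  finally have "nf (g \<otimes> h) = u @ v"
    using s z by (intro nf_eqI) auto
  with z show ?thesis
    using that by blast
qed

end

section \<open>Counting quasimorphisms\<close>

fun occurrences :: "'a list \<Rightarrow> 'a list \<Rightarrow> nat" where
  "occurrences w [] = 0"
| "occurrences w (x # xs) = (if prefix w (x # xs) then 1 else 0) + occurrences w xs"

lemma occurrences_append_ge: "occurrences w xs + occurrences w ys \<le> occurrences w (xs @ ys)"
proof (induction xs)
  case (Cons x xs)
  then show ?case
    using prefix_prefix[of w "x # xs" ys] by auto
qed simp

text \<open>An occurrence that begins in \<open>xs\<close> but runs beyond it begins at one of the
  last \<open>length w\<close> positions of \<open>xs\<close>.\<close>

lemma occurrences_append_le:
  "occurrences w (xs @ ys) \<le> occurrences w xs + occurrences w ys + min (length xs) (length w)"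
proof (induction xs)
  case (Cons x xs)
  have "prefix w (x # xs)" if "prefix w ((x # xs) @ ys)" "length w \<le> length (x # xs)"
    using that by (metis prefix_append prefix_length_prefix prefix_order.refl)
  with Cons show ?case
    by (cases "length w \<le> length (x # xs)") auto
qed simp

text \<open>The count recurses from the left, but inversion reverses words; this is the matching
  recursion from the right.\<close>

lemma occurrences_snoc:
  assumes "w \<noteq> []"
  shows "occurrences w (xs @ [x]) = occurrences w xs + (if suffix w (xs @ [x]) then 1 else 0)"
proof (induction xs)
  case Nil
  have "prefix w [x] \<longleftrightarrow> suffix w [x]"
    using assms by (cases w) (auto simp: suffix_Cons prefix_Cons)
  then show ?case
    by simp
next
  case (Cons y xs)
  have "prefix w (y # xs @ [x]) \<longleftrightarrow> prefix w (y # xs) \<or> w = y # xs @ [x]"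
    using prefix_snoc[of w "y # xs" x] by auto
  moreover have "suffix w (y # xs @ [x]) \<longleftrightarrow> suffix w (xs @ [x]) \<or> w = y # xs @ [x]"
    by (auto simp: suffix_Cons)
  moreover have "\<not> prefix w (y # xs) \<and> \<not> suffix w (xs @ [x])" if "w = y # xs @ [x]"
    using that by (auto dest: prefix_length_le suffix_length_le)
  ultimately show ?case
    using Cons.IH by auto
qed

lemma suffix_inv_word_iff: "suffix (inv_word u) (inv_word v) \<longleftrightarrow> prefix u v"
proof
  assume "suffix (inv_word u) (inv_word v)"
  then obtain t where "inv_word v = t @ inv_word u"
    by (auto simp: suffix_def)
  then have "v = u @ inv_word t"
    by (metis inv_word_append inv_word_inv_word)
  then show "prefix u v"
    by simp
qed (auto simp: prefix_def suffix_def)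

lemma occurrences_inv_word:
  assumes "w \<noteq> []"
  shows "occurrences (inv_word w) (inv_word xs) = occurrences w xs"
proof (induction xs)
  case (Cons x xs)
  have "suffix (inv_word w) (inv_word xs @ [inv_letter x]) \<longleftrightarrow> prefix w (x # xs)"
    using suffix_inv_word_iff[of w "x # xs"] by simp
  then show ?case
    using Cons.IH occurrences_snoc[of "inv_word w" "inv_word xs" "inv_letter x"] assms by simp
qed simp

lemma occurrences_eq_0_iff:
  assumes "w \<noteq> []"
  shows "occurrences w xs = 0 \<longleftrightarrow> \<not> sublist w xs"
proof (induction xs)
  case (Cons x xs)
  then show ?case
    by (auto simp: sublist_Cons_right)
qed (use assms in simp)

text \<open>Subtracting the count of the inverse word makes the function odd under inversion, so
  that blocks which cancel in a product contribute nothing. Overlapping occurrences all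
  count.\<close>

definition brooks :: "('a \<times> bool) list \<Rightarrow> ('a \<times> bool) list \<Rightarrow> int" where
  "brooks w xs = int (occurrences w xs) - int (occurrences (inv_word w) xs)"

lemma brooks_Nil [simp]: "brooks w [] = 0"
  by (simp add: brooks_def)

lemma brooks_append: "\<bar>brooks w (xs @ ys) - brooks w xs - brooks w ys\<bar> \<le> int (length w)"
  using occurrences_append_ge[of w xs ys] occurrences_append_le[of w xs ys]
    occurrences_append_ge[of "inv_word w" xs ys] occurrences_append_le[of "inv_word w" xs ys]
  unfolding brooks_def length_inv_word by linarith

lemma brooks_inv_word: "w \<noteq> [] \<Longrightarrow> brooks w (inv_word xs) = - brooks w xs"
  using occurrences_inv_word[of w xs] occurrences_inv_word[of "inv_word w" xs]
  by (simp add: brooks_def)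

text \<open>Each of the three sides of the tripod is a concatenation of two legs and costs at most
  \<open>length w\<close>; the values at \<open>z\<close> and its inverse cancel.\<close>

lemma (in free_group_basis) quasimorphism_brooks:
  assumes "w \<noteq> []"
  shows "quasimorphism G (3 * length w) (\<lambda>x. brooks w (nf x))"
  unfolding quasimorphism_def
proof (intro conjI ballI)
  fix x y assume "x \<in> carrier G" "y \<in> carrier G"
  then obtain u z v where "nf x = u @ z" "nf y = inv_word z @ v" "nf (x \<otimes> y) = u @ v"
    using nf_mult by blast
  then show "\<bar>brooks w (nf (x \<otimes> y)) - brooks w (nf x) - brooks w (nf y)\<bar> \<le> int (3 * length w)"
    using brooks_append[of w u z] brooks_append[of w "inv_word z" v] brooks_append[of w u v]
      brooks_inv_word[OF assms, of z] by simp
qed simp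

section \<open>Half-spaces of a free splitting\<close>

locale free_product = group G for G (structure) +
  fixes H K :: "'a set"
  assumes decomp: "free_product_decomp G H K"
begin

definition factor :: "bool \<Rightarrow> 'a set" where
  "factor i = (if i then H else K)"

definition syllable_word :: "(bool \<times> 'a) list \<Rightarrow> bool" where
  "syllable_word w \<longleftrightarrow> (\<forall>s\<in>set w. snd s \<in> factor (fst s) \<and> snd s \<noteq> \<one>) \<and>
     successively (\<lambda>s t. fst s \<noteq> fst t) w"

definition syllable_value :: "(bool \<times> 'a) list \<Rightarrow> 'a" where
  "syllable_value w = foldr (\<lambda>s g. snd s \<otimes> g) w \<one>"

lemma subgroup_factor: "subgroup (factor i) G"
  using decomp by (auto simp: factor_def free_product_decomp_def)

lemma factor_carrier: "x \<in> factor i \<Longrightarrow> x \<in> carrier G"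
  using subgroup.mem_carrier[OF subgroup_factor] .

lemma syllable_value_Nil [simp]: "syllable_value [] = \<one>"
  by (simp add: syllable_value_def)

lemma syllable_value_Cons [simp]: "syllable_value (s # w) = snd s \<otimes> syllable_value w"
  by (simp add: syllable_value_def)

lemma syllable_word_Nil [simp]: "syllable_word []"
  by (simp add: syllable_word_def)

lemma syllable_word_Cons:
  "syllable_word (s # w) \<longleftrightarrow> snd s \<in> factor (fst s) \<and> snd s \<noteq> \<one> \<and> syllable_word w \<and>
     (w = [] \<or> fst (hd w) \<noteq> fst s)"
  by (auto simp: syllable_word_def successively_Cons)

lemma syllable_word_append:
  "syllable_word (u @ v) \<longleftrightarrow> syllable_word u \<and> syllable_word v \<and>
     (u = [] \<or> v = [] \<or> fst (last u) \<noteq> fst (hd v))"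
  by (auto simp: syllable_word_def successively_append_iff)

lemma syllable_value_closed [simp]: "syllable_word w \<Longrightarrow> syllable_value w \<in> carrier G"
  by (induction w) (auto simp: syllable_word_Cons factor_carrier)

lemma syllable_value_append:
  "syllable_word u \<Longrightarrow> syllable_word v \<Longrightarrow>
     syllable_value (u @ v) = syllable_value u \<otimes> syllable_value v"
  by (induction u) (auto simp: syllable_word_Cons m_assoc factor_carrier)

lemma syllable_value_neq_one:
  assumes "syllable_word w" "w \<noteq> []"
  shows "syllable_value w \<noteq> \<one>"
proof -
  have "foldr (\<lambda>(i, x) g. x \<otimes> g) w \<one> \<noteq> \<one>"
    using decomp assms unfolding free_product_decomp_def syllable_word_def
    by (auto simp: case_prod_unfold factor_def)
  then show ?thesis
    by (simp add: syllable_value_def case_prod_unfold)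
qed

text \<open>Only the last syllable is affected: a new one is appended, or the last one is modified,
  or it disappears. The first tag therefore survives unless the word becomes empty.\<close>

lemma syllable_value_mult_factor:
  assumes w: "syllable_word w" and h: "h \<in> factor i"
  obtains w' where "syllable_word w'" "syllable_value w' = syllable_value w \<otimes> h"
    "w' = [] \<or> fst (hd w') = (if w = [] then i else fst (hd w))"
proof (cases "h = \<one>")
  case True
  then show ?thesis
    using that[of w] w by simp
next
  case h1: False
  have hc: "h \<in> carrier G"
    using h factor_carrier by blast
  show ?thesis
  proof (cases "w = [] \<or> fst (last w) \<noteq> i")
    case True
    then have a: "syllable_word (w @ [(i, h)])"
      using w h h1 by (auto simp: syllable_word_append syllable_word_Cons)
    then have "syllable_value (w @ [(i, h)]) = syllable_value w \<otimes> h"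
      using hc w by (subst syllable_value_append) (auto simp: syllable_word_append)
    with a show ?thesis
      using that[of "w @ [(i, h)]"] by (cases w) auto
  next
    case False
    then obtain v t where t: "w = v @ [t]"
      by (cases w rule: rev_cases) auto
    then obtain x where v: "w = v @ [(i, x)]"
      using False by (cases t) auto
    have x: "x \<in> factor i" "syllable_word v" "v = [] \<or> fst (last v) \<noteq> i" "syllable_word [(i, x)]"
      using w v by (auto simp: syllable_word_append syllable_word_Cons)
    have xc: "x \<in> carrier G"
      using x factor_carrier by blast
    have val: "syllable_value w \<otimes> h = syllable_value v \<otimes> (x \<otimes> h)"
      using v x xc hc by (simp add: syllable_value_append m_assoc)
    show ?thesis
    proof (cases "x \<otimes> h = \<one>")
      case True
      then have "syllable_value v = syllable_value w \<otimes> h"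
        using val x by simp
      moreover have "v = [] \<or> fst (hd v) = (if w = [] then i else fst (hd w))"
        using v by (cases v) auto
      ultimately show ?thesis
        by (rule that[OF x(2)])
    next
      case False
      have "x \<otimes> h \<in> factor i"
        using subgroup.m_closed[OF subgroup_factor] x h by blast
      then have a: "syllable_word (v @ [(i, x \<otimes> h)])"
        using x False by (auto simp: syllable_word_append syllable_word_Cons)
      then have "syllable_value (v @ [(i, x \<otimes> h)]) = syllable_value v \<otimes> (x \<otimes> h)"
        using hc xc x by (subst syllable_value_append) (auto simp: syllable_word_append)
      moreover have "fst (hd (v @ [(i, x \<otimes> h)])) = (if w = [] then i else fst (hd w))"
        using v by (cases v) auto
      ultimately show ?thesis
        using that[OF a] val by simp
    qed
  qed
qed

lemma syllable_word_exists:
  assumes "g \<in> carrier G"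
  obtains w where "syllable_word w" "syllable_value w = g"
proof -
  have F: "\<exists>i. x \<in> factor i \<and> inv x \<in> factor i" if "x \<in> H \<union> K" for x
    using that subgroup.m_inv_closed[OF subgroup_factor, of x True]
      subgroup.m_inv_closed[OF subgroup_factor, of x False] by (auto simp: factor_def)
  have c: "H \<union> K \<subseteq> carrier G"
    using factor_carrier[of _ True] factor_carrier[of _ False] by (auto simp: factor_def)
  have "g \<in> generate G (H \<union> K)"
    using assms decomp by (simp add: free_product_decomp_def)
  \<comment> \<open>The claim is generalized over a word \<open>w\<close> on the left because
    \<open>generate\<close> forms products of two arbitrary elements, not one generator at a
    time.\<close>
  then have "\<exists>w'. syllable_word w' \<and> syllable_value w' = syllable_value w \<otimes> g" if "syllable_word w" for w
    using that
  proof (induction arbitrary: w)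
    case one
    then show ?case
      by (intro exI[of _ w]) simp
  next
    case (incl h)
    then show ?case
      using F[of h] syllable_value_mult_factor[of w h] by metis
  next
    case (inv h)
    then show ?case
      using F[of h] syllable_value_mult_factor[of w "inv h"] by metis
  next
    case (eng x y)
    then obtain w1 where w1: "syllable_word w1" "syllable_value w1 = syllable_value w \<otimes> x"
      by blast
    then obtain w2 where w2: "syllable_word w2" "syllable_value w2 = syllable_value w1 \<otimes> y"
      using eng.IH(2) by blast
    have "x \<in> carrier G" "y \<in> carrier G"
      using eng.hyps generate_in_carrier[OF c] by auto
    then have "syllable_value w2 = syllable_value w \<otimes> (x \<otimes> y)"
      using w1 w2 eng.prems by (simp add: m_assoc)
    with w2 show ?case
      by blast
  qed
  from this[of "[]"] show ?thesis
    using that assms by auto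
qed

text \<open>With the identity included, \<open>half i\<close> is exactly invariant under right multiplication by \<open>factor i\<close>.\<close>
definition half :: "bool \<Rightarrow> 'a set" where
  "half i = insert \<one> {syllable_value w | w. syllable_word w \<and> w \<noteq> [] \<and> fst (hd w) = i}"

lemma half_carrier: "x \<in> half i \<Longrightarrow> x \<in> carrier G"
  by (auto simp: half_def)

lemma halfI: "syllable_word w \<Longrightarrow> w = [] \<or> fst (hd w) = i \<Longrightarrow> syllable_value w \<in> half i"
  by (auto simp: half_def)

lemma halfE:
  assumes "x \<in> half i"
  obtains w where "syllable_word w" "w = [] \<or> fst (hd w) = i" "x = syllable_value w"
  using assms syllable_word_Nil by (force simp: half_def)

lemma half_cases: "x \<in> carrier G \<Longrightarrow> x \<in> half True \<or> x \<in> half False"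
  using syllable_word_exists[of x] halfI by (metis (full_types))

fun inv_syllable :: "bool \<times> 'a \<Rightarrow> bool \<times> 'a" where
  "inv_syllable (i, x) = (i, inv x)"

lemma inv_syllable_word:
  assumes "syllable_word w"
  shows "syllable_word (rev (map inv_syllable w)) \<and>
    syllable_value (rev (map inv_syllable w)) = inv (syllable_value w)"
  using assms
proof (induction w)
  case (Cons s w)
  obtain i x where s: "s = (i, x)"
    by (cases s)
  have x: "x \<in> factor i" "x \<noteq> \<one>" "syllable_word w" "w = [] \<or> fst (hd w) \<noteq> i"
    using Cons.prems s by (auto simp: syllable_word_Cons)
  then have xc: "x \<in> carrier G" "inv x \<in> factor i" "inv x \<noteq> \<one>"
    using factor_carrier subgroup.m_inv_closed[OF subgroup_factor] inv_eq_1_iff by blast+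
  let ?r = "rev (map inv_syllable w)"
  have IH: "syllable_word ?r" "syllable_value ?r = inv (syllable_value w)"
    using Cons.IH x by auto
  have "fst (last ?r) \<noteq> i" if "w \<noteq> []"
    using that x(4) by (cases w; cases "hd w") auto
  then have a: "syllable_word (?r @ [(i, inv x)])"
    using IH xc by (auto simp: syllable_word_append syllable_word_Cons)
  then have "syllable_value (?r @ [(i, inv x)]) = inv (syllable_value w) \<otimes> inv x"
    using IH xc by (subst syllable_value_append) (auto simp: syllable_word_append)
  with a s xc x show ?case
    by (simp add: inv_mult_group)
qed simp

text \<open>Given words for \<open>x\<close> that start in different factors, the inverse of the one
  followed by the other would be an alternating word of value one.\<close>

lemma half_inter: "x \<in> half True \<Longrightarrow> x \<in> half False \<Longrightarrow> x = \<one>"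
proof (rule ccontr)
  assume "x \<in> half True" "x \<in> half False" and x: "x \<noteq> \<one>"
  then obtain u v where u: "syllable_word u" "u = [] \<or> fst (hd u) = True" "x = syllable_value u"
    and v: "syllable_word v" "v = [] \<or> fst (hd v) = False" "x = syllable_value v"
    by (metis halfE)
  then have ne: "u \<noteq> []" "v \<noteq> []"
    using x by auto
  let ?r = "rev (map inv_syllable u)"
  have r: "syllable_word ?r" "syllable_value ?r = inv x"
    using inv_syllable_word[OF u(1)] u(3) by auto
  have "fst (last ?r) = True"
    using u ne by (cases u; cases "hd u") auto
  then have a: "syllable_word (?r @ v)"
    using r v ne by (auto simp: syllable_word_append)
  have "syllable_value (?r @ v) = inv x \<otimes> x"
    using r v by (simp add: syllable_value_append)
  also have "\<dots> = \<one>"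
    using u by simp
  finally show False
    using syllable_value_neq_one[OF a] ne by simp
qed

lemma half_mult_factor:
  assumes "x \<in> half i" "h \<in> factor i"
  shows "x \<otimes> h \<in> half i"
proof -
  obtain w where w: "syllable_word w" "w = [] \<or> fst (hd w) = i" "x = syllable_value w"
    using assms(1) by (rule halfE)
  obtain w' where "syllable_word w'" "syllable_value w' = syllable_value w \<otimes> h"
    "w' = [] \<or> fst (hd w') = (if w = [] then i else fst (hd w))"
    using syllable_value_mult_factor[OF w(1) assms(2)] by blast
  then show ?thesis
    using w halfI[of w' i] by (auto split: if_splits)
qed

lemma half_mult_factor_iff:
  assumes x: "x \<in> carrier G" and h: "h \<in> factor i"
  shows "x \<otimes> h \<in> half i \<longleftrightarrow> x \<in> half i"
proof
  assume a: "x \<otimes> h \<in> half i"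
  have "x \<otimes> h \<otimes> inv h \<in> half i"
    by (rule half_mult_factor[OF a subgroup.m_inv_closed[OF subgroup_factor h]])
  then show "x \<in> half i"
    using x factor_carrier[OF h] by (simp add: m_assoc)
qed (rule half_mult_factor[OF _ h])

text \<open>This is the ping-pong step; nothing cancels because the tags differ.\<close>

lemma factor_mult_half:
  assumes "x \<in> half (\<not> i)" "h \<in> factor i" "h \<noteq> \<one>"
  shows "h \<otimes> x \<in> half i" "h \<otimes> x \<noteq> \<one>"
proof -
  obtain w where w: "syllable_word w" "w = [] \<or> fst (hd w) = (\<not> i)" "x = syllable_value w"
    using assms(1) by (rule halfE)
  then have a: "syllable_word ((i, h) # w)"
    using assms by (auto simp: syllable_word_Cons)
  then show "h \<otimes> x \<in> half i" "h \<otimes> x \<noteq> \<one>"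
    using halfI[OF a, of i] syllable_value_neq_one[OF a] w by auto
qed

lemma one_half [simp]: "\<one> \<in> half i"
  by (simp add: half_def)

text \<open>In the language of ends, \<open>half True\<close> is an almost invariant set. It has no
  boundary with respect to elements of \<open>H\<close>. With respect to \<open>b\<close> in
  \<open>K\<close>, invariance holds for \<open>half False\<close>, the complement enlarged by the
  identity, so only \<open>1\<close> and \<open>inv b\<close> can be boundary points. For products,
  the boundary is covered by that of the first element and a translate of that of the
  second.\<close>

lemma finite_half_boundary:
  assumes "b \<in> carrier G"
  shows "finite {x \<in> carrier G. (x \<in> half True) \<noteq> (x \<otimes> b \<in> half True)}"
proof -
  have c: "H \<union> K \<subseteq> carrier G"
    using factor_carrier[of _ True] factor_carrier[of _ False] by (auto simp: factor_def)
  have step: "finite {x \<in> carrier G. (x \<in> half True) \<noteq> (x \<otimes> b \<in> half True)}" if b: "b \<in> factor i" for b i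
  proof (cases i)
    case True
    then have "{x \<in> carrier G. (x \<in> half True) \<noteq> (x \<otimes> b \<in> half True)} = {}"
      using half_mult_factor_iff[of _ b True] b by auto
    then show ?thesis
      by (simp only: finite.emptyI)
  next
    case False
    have bc: "b \<in> carrier G"
      using b factor_carrier by blast
    have "x = \<one> \<or> x = inv b" if x: "x \<in> carrier G" "(x \<in> half True) \<noteq> (x \<otimes> b \<in> half True)" for x
    proof -
      have "x \<otimes> b \<in> half False \<longleftrightarrow> x \<in> half False"
        using half_mult_factor_iff[of x b False] b False x by simp
      then have "x = \<one> \<or> x \<otimes> b = \<one>"
        using x bc half_cases[of x] half_cases[of "x \<otimes> b"] half_inter by blast
      then show ?thesis
        using x bc by (metis inv_equality inv_inv)
    qed
    then have "{x \<in> carrier G. (x \<in> half True) \<noteq> (x \<otimes> b \<in> half True)} \<subseteq> {\<one>, inv b}"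
      by blast
    then show ?thesis
      by (rule finite_subset) simp
  qed
  have "b \<in> generate G (H \<union> K)"
    using assms decomp by (simp add: free_product_decomp_def)
  then show ?thesis
  proof induction
    case one
    have "{x \<in> carrier G. (x \<in> half True) \<noteq> (x \<otimes> \<one> \<in> half True)} = {}"
      by auto
    then show ?case
      by (simp only: finite.emptyI)
  next
    case (incl b)
    then show ?case
      using step[of b True] step[of b False] by (auto simp: factor_def)
  next
    case (inv b)
    then show ?case
      using step[of "inv b" True] step[of "inv b" False]
        subgroup.m_inv_closed[OF subgroup_factor, of b True]
        subgroup.m_inv_closed[OF subgroup_factor, of b False] by (auto simp: factor_def)
  next
    case (eng a b)
    let ?B = "\<lambda>b. {x \<in> carrier G. (x \<in> half True) \<noteq> (x \<otimes> b \<in> half True)}"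
    have ab: "a \<in> carrier G" "b \<in> carrier G"
      using eng.hyps generate_in_carrier[OF c] by auto
    have "?B (a \<otimes> b) \<subseteq> ?B a \<union> (\<lambda>x. x \<otimes> inv a) ` ?B b"
    proof
      fix x assume x: "x \<in> ?B (a \<otimes> b)"
      then have xc: "x \<in> carrier G"
        by simp
      have "x = x \<otimes> a \<otimes> inv a" "x \<otimes> (a \<otimes> b) = x \<otimes> a \<otimes> b"
        using xc ab by (simp_all add: m_assoc)
      then show "x \<in> ?B a \<union> (\<lambda>x. x \<otimes> inv a) ` ?B b"
        using x xc ab by (cases "x \<in> ?B a") auto
    qed
    then show ?case
      by (rule finite_subset) (intro finite_UnI finite_imageI eng.IH)
  qed
qed

text \<open>By ping-pong, multiplying by \<open>k\<close> and then by \<open>h\<close> on the left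
  maps \<open>half i - {1}\<close> injectively into itself. If the set were finite, the map would be
  onto; but reaching \<open>h\<close> would require \<open>k \<otimes> x = 1\<close>.\<close>

lemma infinite_half:
  assumes h: "h \<in> factor i" "h \<noteq> \<one>" and k: "k \<in> factor (\<not> i)" "k \<noteq> \<one>"
  shows "infinite (half i - {\<one>})"
proof
  assume fin: "finite (half i - {\<one>})"
  have hk: "h \<in> carrier G" "k \<in> carrier G"
    using h k factor_carrier by auto
  have m: "h \<otimes> (k \<otimes> x) \<in> half i - {\<one>}" if "x \<in> half i" for x
    using factor_mult_half[OF _ h] factor_mult_half[of x "\<not> i" k] that k by simp
  have "inj_on (\<lambda>x. h \<otimes> (k \<otimes> x)) (half i - {\<one>})"
    using hk half_carrier by (intro inj_onI) auto
  then have "(\<lambda>x. h \<otimes> (k \<otimes> x)) ` (half i - {\<one>}) = half i - {\<one>}"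
    using fin m by (intro card_subset_eq) (auto simp: card_image)
  moreover have "h \<in> half i - {\<one>}"
    using factor_mult_half[of \<one> i h] h hk by simp
  ultimately obtain x where x: "x \<in> half i" "x \<noteq> \<one>" "h = h \<otimes> (k \<otimes> x)"
    by blast
  then have "k \<otimes> x = \<one>"
    using hk half_carrier[OF x(1)] by (metis l_cancel_one' m_closed)
  then show False
    using factor_mult_half(2)[of x "\<not> i" k] x k by simp
qed

end

lemma (in group) free_factor_half_space:
  assumes "proper_free_factor G H"
  obtains P where "P \<subseteq> carrier G" "\<forall>x\<in>carrier G. \<forall>h\<in>H. x \<otimes> h \<in> P \<longleftrightarrow> x \<in> P"
    "\<forall>b\<in>carrier G. finite {x \<in> carrier G. (x \<in> P) \<noteq> (x \<otimes> b \<in> P)}"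
    "infinite P" "infinite (carrier G - P)"
proof -
  obtain K where HK: "free_product_decomp G H K" "H \<noteq> {\<one>}" "K \<noteq> {\<one>}"
    using assms by (auto simp: proper_free_factor_def nontrivial_proper_subgroup_def)
  interpret free_product G H K
    by unfold_locales (rule HK)
  have "\<one> \<in> H" "\<one> \<in> K"
    using subgroup.one_closed[OF subgroup_factor[of True]] subgroup.one_closed[OF subgroup_factor[of False]]
    by (auto simp: factor_def)
  then obtain h k where hk: "h \<in> H" "h \<noteq> \<one>" "k \<in> K" "k \<noteq> \<one>"
    using HK by blast
  have "infinite (half True - {\<one>})" "infinite (half False - {\<one>})"
    using infinite_half[of h True k] infinite_half[of k False h] hk by (auto simp: factor_def)
  moreover have "half False - {\<one>} \<subseteq> carrier G - half True"
    using half_carrier half_inter by blast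
  ultimately have "infinite (half True)" "infinite (carrier G - half True)"
    by (auto dest: finite_subset)
  then show ?thesis
    using that[of "half True"] half_carrier half_mult_factor_iff[of _ _ True] finite_half_boundary
    by (auto simp: factor_def)
qed

section \<open>Separable elements and Whitehead graphs\<close>

definition word_power :: "nat \<Rightarrow> 'a list \<Rightarrow> 'a list" where
  "word_power k u = concat (replicate k u)"

lemma word_power_0 [simp]: "word_power 0 u = []"
  by (simp add: word_power_def)

lemma word_power_Suc: "word_power (Suc k) u = u @ word_power k u"
  by (simp add: word_power_def)

lemma word_power_Suc_right: "word_power (Suc k) u = word_power k u @ u"
  by (induction k) (auto simp: word_power_Suc)

lemma length_word_power [simp]: "length (word_power k u) = k * length u"
  by (induction k) (auto simp: word_power_Suc)

lemma set_word_power: "set (word_power k u) \<subseteq> set u"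
  by (induction k) (auto simp: word_power_Suc)

lemma reduced_word_power:
  assumes "reduced_word (u @ u)"
  shows "reduced_word (word_power k u)"
proof (induction k)
  case (Suc k)
  then show ?case
    using assms by (cases k) (auto simp: word_power_Suc reduced_word_append)
qed simp

text \<open>In the Whitehead graph a subword \<open>[x, y]\<close> joins the vertices
  \<open>inv_letter x\<close> and \<open>y\<close>. The condition asks for an edge between any two
  distinct vertices, in both orders.\<close>

definition all_transitions :: "'a set \<Rightarrow> ('a \<times> bool) list \<Rightarrow> bool" where
  "all_transitions B w \<longleftrightarrow>
     (\<forall>x\<in>B \<times> UNIV. \<forall>y\<in>B \<times> UNIV. y \<noteq> inv_letter x \<longrightarrow> sublist [x, y] w)"

lemma all_transitionsD:
  "all_transitions B w \<Longrightarrow> x \<in> B \<times> UNIV \<Longrightarrow> y \<in> B \<times> UNIV \<Longrightarrow> y \<noteq> inv_letter x \<Longrightarrow> sublist [x, y] w"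
  unfolding all_transitions_def by ((drule (1) bspec)+, erule mp)

lemma all_transitions_sublist: "all_transitions B w \<Longrightarrow> sublist w u \<Longrightarrow> all_transitions B u"
  unfolding all_transitions_def by (meson sublist_order.order_trans)

lemma sublist_inv_word: "sublist u v \<Longrightarrow> sublist (inv_word u) (inv_word v)"
  by (force simp: sublist_def)

lemma all_transitions_inv_word:
  assumes "all_transitions B w"
  shows "all_transitions B (inv_word w)"
  unfolding all_transitions_def
proof (intro ballI impI)
  fix x y assume xy: "x \<in> B \<times> UNIV" "y \<in> B \<times> UNIV" "y \<noteq> inv_letter x"
  then have "inv_letter y \<in> B \<times> UNIV" "inv_letter x \<in> B \<times> UNIV" "inv_letter x \<noteq> inv_letter (inv_letter y)"
    by (simp_all only: inv_letter_mem_iff) auto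
  then have "sublist [inv_letter y, inv_letter x] w"
    by (rule all_transitionsD[OF assms])
  then show "sublist [x, y] (inv_word w)"
    using sublist_inv_word[of "[inv_letter y, inv_letter x]" w] by simp
qed

context free_group_basis
begin

text \<open>
  The case of Whitehead's cut vertex lemma in which the Whitehead graph of \<open>u\<close> is complete.
  Each half of a line of \<open>u\<close> in the Cayley tree has an eventual colour (in \<open>P\<close> or not),
  and both ends of a line have the same colour. Going down from a ball that contains the
  boundary of \<open>P\<close>, the branches at a vertex are joined pairwise by such lines, so they have equal colours.
\<close>
lemma whitehead_complete:
  assumes B: "finite B" and u: "set u \<subseteq> B \<times> UNIV" "u \<noteq> []" "reduced_word (u @ u)" "all_transitions B u"
    and Pu: "\<And>x. x \<in> carrier G \<Longrightarrow> x \<otimes> word_value G u \<in> P \<longleftrightarrow> x \<in> P"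
    and boundary: "\<And>b. b \<in> carrier G \<Longrightarrow> finite {x \<in> carrier G. (x \<in> P) \<noteq> (x \<otimes> b \<in> P)}"
    and P: "P \<subseteq> carrier G"
  shows "finite P \<or> finite (carrier G - P)"
proof -
  define c where "c w \<longleftrightarrow> word_value G w \<in> P" for w
  define rw where "rw w \<longleftrightarrow> set w \<subseteq> B \<times> UNIV \<and> reduced_word w" for w
  have rw_val: "word_value G w \<in> carrier G" "nf (word_value G w) = w" if "rw w" for w
    using that word_value_closed[OF words_carrier] nf_eqI unfolding rw_def by blast+
  \<comment> \<open>These are the tails of the edges of the Cayley tree whose two ends have
    different colours.\<close>
  define X where "X = (\<Union>b\<in>B. {x \<in> carrier G. (x \<in> P) \<noteq> (x \<otimes> b \<in> P)})"
  have "finite X"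
    unfolding X_def using B boundary basis_carrier by blast
  then have "finite ((\<lambda>x. length (nf x)) ` X)"
    by simp
  then obtain R0 where R0: "\<And>x. x \<in> X \<Longrightarrow> length (nf x) \<le> R0"
    unfolding finite_nat_set_iff_bounded_le by blast
  \<comment> \<open>The strict margin handles both orientations: an edge leading outward from
    distance at least \<open>R\<close> has neither end in \<open>X\<close>, whichever of them is its
    tail.\<close>
  define R where "R = Suc R0"
  have R: "length (nf x) < R" if "x \<in> X" for x
    using R0[OF that] by (simp add: R_def)
  have step: "c (w @ [x]) = c w" if w: "rw (w @ [x])" "R \<le> length w" for w x
  proof (rule ccontr)
    assume neq: "c (w @ [x]) \<noteq> c w"
    have w': "rw w"
      using w by (auto simp: rw_def reduced_word_append)
    obtain b e where x: "x = (b, e)"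
      by (cases x)
    have b: "b \<in> B" "b \<in> carrier G"
      using w x basis_carrier by (auto simp: rw_def)
    have val: "word_value G (w @ [x]) = word_value G w \<otimes> (if e then b else inv b)"
      using w' x b words_carrier by (subst word_value_append) (auto simp: rw_def)
    show False
    proof (cases e)
      case True
      then have "word_value G w \<in> X"
        using neq val b rw_val[OF w'] by (auto simp: X_def c_def)
      then show False
        using R rw_val[OF w'] w(2) by fastforce
    next
      case False
      have "word_value G (w @ [x]) \<otimes> b = word_value G w"
        using val False b rw_val[OF w'] by (simp add: m_assoc)
      then have "word_value G (w @ [x]) \<in> X"
        unfolding X_def using neq[unfolded c_def] b rw_val[OF w(1)] by (intro UN_I[of b]) auto
      then show False
        using R rw_val[OF w(1)] w(2) by fastforce
    qed
  qed
  have far: "c (w @ v) = c w" if "rw (w @ v)" "R \<le> length w" for w v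
    using that
  proof (induction v rule: rev_induct)
    case (snoc x v)
    have "rw (w @ v)"
      using snoc.prems by (auto simp: rw_def reduced_word_append)
    then show ?case
      using step[of "w @ v" x] snoc by simp
  qed simp
  have Pu_power: "x \<otimes> word_value G (word_power k u) \<in> P \<longleftrightarrow> x \<in> P" if "x \<in> carrier G" for x k
  proof (induction k)
    case (Suc k)
    have s: "set u \<subseteq> carrier G \<times> UNIV" "set (word_power k u) \<subseteq> carrier G \<times> UNIV"
      using u(1) words_carrier set_word_power[of k u] by auto
    then have "x \<otimes> word_value G (word_power (Suc k) u) = x \<otimes> word_value G (word_power k u) \<otimes> word_value G u"
      using that by (simp add: word_power_Suc_right word_value_append m_assoc)
    then show ?case
      using Suc Pu[of "x \<otimes> word_value G (word_power k u)"] that s by simp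
  qed (use that in simp)
  \<comment> \<open>Induction on \<open>n\<close>, the amount by which the common prefix
    \<open>v\<close> falls short of length \<open>R\<close>: all far words with prefix
    \<open>v\<close> have the same colour.\<close>
  have colour: "c (v @ s) = c (v @ t)"
    if "length v + n = R" "rw (v @ s)" "rw (v @ t)" "R \<le> length (v @ s)" "R \<le> length (v @ t)" for n v s t
    using that
  proof (induction n arbitrary: v s t)
    case 0
    then show ?case
      using far[of v s] far[of v t] by simp
  next
    case (Suc n)
    obtain x s' where s: "s = x # s'"
      using Suc.prems by (cases s) auto
    obtain y t' where t: "t = y # t'"
      using Suc.prems by (cases t) auto
    have IH: "c (v @ z # s1) = c (v @ z # s2)"
      if "rw (v @ z # s1)" "rw (v @ z # s2)" "R \<le> length (v @ z # s1)" "R \<le> length (v @ z # s2)" for z s1 s2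
      using Suc.IH[of "v @ [z]" s1 s2] Suc.prems(1) that by simp
    have vx: "rw (v @ [x])" "rw (v @ [y])" "rw v"
      using Suc.prems s t by (auto simp: rw_def reduced_word_append reduced_word_Cons)
    show ?case
    proof (cases "x = y")
      case True
      then show ?thesis
        using IH[of x s' t'] Suc.prems s t by blast
    next
      case False
      have "inv_letter x \<in> B \<times> UNIV" "y \<in> B \<times> UNIV" "y \<noteq> inv_letter (inv_letter x)"
        using vx False by (simp_all add: rw_def)
      then have "sublist [inv_letter x, y] u"
        by (rule all_transitionsD[OF u(4)])
      \<comment> \<open>The vertex \<open>v\<close> is placed between the two letters of this
        occurrence. The line through it that spells the powers of \<open>u\<close> leaves
        \<open>v\<close> in the directions \<open>x\<close> and \<open>y\<close>, and
        \<open>R\<close> copies of the nonempty word \<open>u\<close> take each ray beyond distance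
        \<open>R\<close>.\<close>
      then obtain p q where pq: "u = p @ [inv_letter x, y] @ q"
        by (auto simp: sublist_def)
      let ?w = "word_power R u"
      have len: "R \<le> length ?w"
        using u(2) by (cases u) auto
      have red: "reduced_word (word_power (Suc R) u)"
        using u(3) by (rule reduced_word_power)
      have "reduced_word (p @ [inv_letter x] @ y # q @ ?w)"
        using red pq by (simp add: word_power_Suc)
      then have red1: "reduced_word (y # q @ ?w)"
        by (simp only: reduced_word_append)
      have "reduced_word ((?w @ p @ [inv_letter x]) @ y # q)"
        using red pq by (simp add: word_power_Suc_right)
      then have "reduced_word (inv_word (?w @ p @ [inv_letter x]))"
        by (simp only: reduced_word_append reduced_inv_word)
      then have red2: "reduced_word (x # inv_word p @ inv_word ?w)"
        by simp
      have setw: "set ?w \<subseteq> B \<times> UNIV" "set p \<subseteq> B \<times> UNIV" "set q \<subseteq> B \<times> UNIV"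
        "set (inv_word p) \<subseteq> B \<times> UNIV" "set (inv_word ?w) \<subseteq> B \<times> UNIV"
        using u(1) pq set_word_power[of R u] by (auto simp del: set_append) auto
      have rw1: "rw (v @ y # q @ ?w)"
        using red1 vx setw reduced_word_append[of v "y # q @ ?w"]
        by (auto simp: rw_def reduced_word_append[of v "[y]"])
      have rw2: "rw (v @ x # inv_word p @ inv_word ?w)"
        using red2 vx setw reduced_word_append[of v "x # inv_word p @ inv_word ?w"]
        by (auto simp: rw_def reduced_word_append[of v "[x]"])
      have "set v \<subseteq> B \<times> UNIV" "set ?w \<subseteq> B \<times> UNIV" "set p \<subseteq> B \<times> UNIV"
        "set q \<subseteq> B \<times> UNIV" "set u \<subseteq> B \<times> UNIV"
        "set [x] \<subseteq> B \<times> UNIV" "set [y] \<subseteq> B \<times> UNIV" "set [inv_letter x] \<subseteq> B \<times> UNIV"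
        using vx setw u(1) by (simp_all add: rw_def)
      note cl = this[THEN words_carrier]
      let ?V = "word_value G v" and ?X = "word_value G [x]" and ?Y = "word_value G [y]"
        and ?W = "word_value G ?w" and ?P = "word_value G p" and ?Q = "word_value G q"
      have c: "?V \<in> carrier G" "?X \<in> carrier G" "?Y \<in> carrier G" "?W \<in> carrier G" "?P \<in> carrier G" "?Q \<in> carrier G"
        using cl by (simp_all only: word_value_closed)
      have U: "word_value G u = ?P \<otimes> (inv ?X \<otimes> (?Y \<otimes> ?Q))"
      proof -
        have "word_value G u = word_value G (p @ inv_word [x] @ [y] @ q)"
          using pq by simp
        also have "\<dots> = ?P \<otimes> (inv ?X \<otimes> (?Y \<otimes> ?Q))"
          using cl by (simp only: word_value_append word_value_inv_word set_append set_inv_word_subset_iff Un_subset_iff simp_thms)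
        finally show ?thesis .
      qed
      have v1: "word_value G (v @ y # q @ ?w) = ?V \<otimes> (?Y \<otimes> (?Q \<otimes> ?W))"
      proof -
        have "word_value G (v @ y # q @ ?w) = word_value G (v @ [y] @ q @ ?w)"
          by simp
        also have "\<dots> = ?V \<otimes> (?Y \<otimes> (?Q \<otimes> ?W))"
          using cl by (simp only: word_value_append set_append Un_subset_iff simp_thms)
        finally show ?thesis .
      qed
      have v2: "word_value G (v @ x # inv_word p @ inv_word ?w) = ?V \<otimes> (?X \<otimes> (inv ?P \<otimes> inv ?W))"
      proof -
        have "word_value G (v @ x # inv_word p @ inv_word ?w) = word_value G (v @ [x] @ inv_word p @ inv_word ?w)"
          by simp
        also have "\<dots> = ?V \<otimes> (?X \<otimes> (inv ?P \<otimes> inv ?W))"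
          using cl by (simp only: word_value_append word_value_inv_word set_append set_inv_word_subset_iff Un_subset_iff simp_thms)
        finally show ?thesis .
      qed
      \<comment> \<open>\<open>?g\<close> is a far point on the ray in direction \<open>x\<close>.
        Reading \<open>2 * R + 1\<close> copies of \<open>u\<close> from it leads to a far point on
        the ray in direction \<open>y\<close>, and each copy preserves the colour.\<close>
      let ?g = "?V \<otimes> (?X \<otimes> (inv ?P \<otimes> inv ?W))"
      have cancel: "inv a \<otimes> (a \<otimes> b) = b" "a \<otimes> (inv a \<otimes> b) = b" if "a \<in> carrier G" "b \<in> carrier G" for a b
        using that by (simp_all add: m_assoc[symmetric])
      have "?g \<otimes> ?W \<otimes> word_value G u \<otimes> ?W = ?V \<otimes> (?Y \<otimes> (?Q \<otimes> ?W))"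
        unfolding U using c by (simp add: m_assoc cancel del: word_value_Cons)
      moreover have "?g \<otimes> ?W \<otimes> word_value G u \<otimes> ?W \<in> P \<longleftrightarrow> ?g \<in> P"
        using Pu_power[of ?g R] Pu[of "?g \<otimes> ?W"] Pu_power[of "?g \<otimes> ?W \<otimes> word_value G u" R]
          c word_value_closed[OF cl(5)] by (simp del: word_value_Cons)
      ultimately have "c (v @ y # q @ ?w) = c (v @ x # inv_word p @ inv_word ?w)"
        unfolding c_def v1 v2 by simp
      moreover have "c (v @ s) = c (v @ x # inv_word p @ inv_word ?w)"
        unfolding s
      proof (rule IH[OF _ rw2])
        show "R \<le> length (v @ x # inv_word p @ inv_word ?w)"
          by (rule order_trans[OF len]) simp
      qed (use Suc.prems s in auto)
      moreover have "c (v @ t) = c (v @ y # q @ ?w)"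
        unfolding t
      proof (rule IH[OF _ rw1])
        show "R \<le> length (v @ y # q @ ?w)"
          by (rule order_trans[OF len]) simp
      qed (use Suc.prems t in auto)
      ultimately show ?thesis
        by simp
    qed
  qed
  let ?S = "word_value G ` {w. set w \<subseteq> B \<times> (UNIV :: bool set) \<and> length w \<le> R}"
  have fin: "finite ?S"
    using B by (intro finite_imageI finite_lists_length_le) auto
  have nf_c: "c (nf g) \<longleftrightarrow> g \<in> P" "rw (nf g)" if "g \<in> carrier G" for g
    using that word_value_nf set_nf reduced_nf by (auto simp: c_def rw_def)
  have far_or: "g \<in> ?S \<or> R \<le> length (nf g)" if "g \<in> carrier G" for g
    using that word_value_nf[OF that, symmetric] set_nf[OF that] by (auto simp: image_iff)
  have "P \<subseteq> ?S \<or> carrier G - P \<subseteq> ?S"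
  proof (rule ccontr)
    assume "\<not> ?thesis"
    then obtain g h where g: "g \<in> P" "g \<in> carrier G" "g \<notin> ?S" and h: "h \<notin> P" "h \<in> carrier G" "h \<notin> ?S"
      using P by blast
    then have "c (nf g) = c (nf h)"
      using colour[of "[]" R "nf g" "nf h"] nf_c(2) far_or[of g] far_or[of h] by simp
    then show False
      using g h nf_c by simp
  qed
  then show ?thesis
    using fin finite_subset by blast
qed

lemma occurrences_separable:
  assumes B: "finite B" and w: "w \<noteq> []" "all_transitions B w"
    and g: "proper_free_factor G H" "word_value G (y @ u @ inv_word y) \<in> H"
    and yu: "set (y @ u) \<subseteq> B \<times> UNIV" "reduced_word (u @ u)"
  shows "occurrences w u = 0"
proof (rule ccontr)
  assume "occurrences w u \<noteq> 0"
  then have sub: "sublist w u"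
    by (simp add: occurrences_eq_0_iff[OF w(1)])
  have "u \<noteq> []"
    using sub w(1) by (cases u) simp_all
  note u = this all_transitions_sublist[OF w(2) sub]
  obtain P where P: "P \<subseteq> carrier G" and PH: "\<forall>x\<in>carrier G. \<forall>h\<in>H. x \<otimes> h \<in> P \<longleftrightarrow> x \<in> P"
    and bd: "\<forall>b\<in>carrier G. finite {x \<in> carrier G. (x \<in> P) \<noteq> (x \<otimes> b \<in> P)}"
    and inf: "infinite P" "infinite (carrier G - P)"
    by (rule free_factor_half_space[OF g(1)]) (rule that)
  let ?Y = "word_value G y" and ?U = "word_value G u"
  have c: "set y \<subseteq> carrier G \<times> UNIV" "set u \<subseteq> carrier G \<times> UNIV"
    using yu words_carrier by auto
  have Y: "?Y \<in> carrier G" and U: "?U \<in> carrier G"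
    using c by auto
  have gH: "?Y \<otimes> ?U \<otimes> inv ?Y \<in> H"
    using g(2) c Y U by (simp add: word_value_append word_value_inv_word m_assoc)
  \<comment> \<open>This is \<open>P\<close> translated on the right by \<open>?Y\<close>.
    Invariance of \<open>P\<close> under the conjugate of \<open>?U\<close> becomes invariance of
    \<open>P'\<close> under \<open>?U\<close> itself, while finite boundary and infinite sides are
    preserved.\<close>
  define P' where "P' = {x \<in> carrier G. x \<otimes> inv ?Y \<in> P}"
  have "finite P' \<or> finite (carrier G - P')"
  proof (rule whitehead_complete[OF B _ u(1) yu(2) u(2)])
    show "set u \<subseteq> B \<times> UNIV"
      using yu by simp
    show "P' \<subseteq> carrier G"
      by (auto simp: P'_def)
    show "x \<otimes> ?U \<in> P' \<longleftrightarrow> x \<in> P'" if x: "x \<in> carrier G" for x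
    proof -
      have "x \<otimes> ?U \<otimes> inv ?Y = x \<otimes> inv ?Y \<otimes> (?Y \<otimes> ?U \<otimes> inv ?Y)"
        using x Y U by (simp add: m_assoc) (simp add: m_assoc[symmetric])
      then show ?thesis
        using PH[rule_format, of "x \<otimes> inv ?Y", OF _ gH] x Y U by (simp add: P'_def)
    qed
    show "finite {x \<in> carrier G. (x \<in> P') \<noteq> (x \<otimes> b \<in> P')}" if b: "b \<in> carrier G" for b
    proof -
      let ?b = "?Y \<otimes> b \<otimes> inv ?Y"
      have "{x \<in> carrier G. (x \<in> P') \<noteq> (x \<otimes> b \<in> P')} \<subseteq>
          (\<lambda>z. z \<otimes> ?Y) ` {x \<in> carrier G. (x \<in> P) \<noteq> (x \<otimes> ?b \<in> P)}"
      proof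
        fix x assume x: "x \<in> {x \<in> carrier G. (x \<in> P') \<noteq> (x \<otimes> b \<in> P')}"
        then have xc: "x \<in> carrier G"
          by simp
        have "x \<otimes> b \<otimes> inv ?Y = x \<otimes> inv ?Y \<otimes> ?b"
          using xc Y b by (simp add: m_assoc) (simp add: m_assoc[symmetric])
        then have "x \<otimes> inv ?Y \<in> {x \<in> carrier G. (x \<in> P) \<noteq> (x \<otimes> ?b \<in> P)}"
          using x xc b Y by (auto simp: P'_def)
        moreover have "x = x \<otimes> inv ?Y \<otimes> ?Y"
          using xc Y by (simp add: m_assoc)
        ultimately show "x \<in> (\<lambda>z. z \<otimes> ?Y) ` {x \<in> carrier G. (x \<in> P) \<noteq> (x \<otimes> ?b \<in> P)}"
          by blast
      qed
      then show ?thesis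
        by (rule finite_subset) (intro finite_imageI bd[rule_format], use b Y in simp)
    qed
  qed
  moreover have "P \<subseteq> (\<lambda>x. x \<otimes> inv ?Y) ` P'" "carrier G - P \<subseteq> (\<lambda>x. x \<otimes> inv ?Y) ` (carrier G - P')"
  proof -
    have z: "z = z \<otimes> ?Y \<otimes> inv ?Y" if "z \<in> carrier G" for z
      using that Y by (simp add: m_assoc)
    show "P \<subseteq> (\<lambda>x. x \<otimes> inv ?Y) ` P'"
      using z P Y by (fastforce simp: P'_def)
    show "carrier G - P \<subseteq> (\<lambda>x. x \<otimes> inv ?Y) ` (carrier G - P')"
      using z P Y by (fastforce simp: P'_def)
  qed
  ultimately show False
    using inf by (meson finite_imageI finite_subset)
qed

text \<open>The cyclically reduced core contributes nothing, the conjugating word and its inverse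
  cancel, and the two junctions cost \<open>length w\<close> each.\<close>

lemma brooks_separable:
  assumes B: "finite B" and w: "w \<noteq> []" "all_transitions B w" and g: "g \<in> separable_elements G"
  shows "\<bar>brooks w (nf g)\<bar> \<le> int (2 * length w)"
proof -
  obtain H where H: "proper_free_factor G H" "g \<in> H"
    using g by (auto simp: separable_elements_def)
  then have gc: "g \<in> carrier G"
    using subgroup.mem_carrier by (force simp: proper_free_factor_def nontrivial_proper_subgroup_def)
  obtain y u where yu: "nf g = y @ u @ inv_word y" "reduced_word (u @ u)"
    using cyclic_reduction[OF reduced_nf[OF gc]] by blast
  have s: "set (y @ u) \<subseteq> B \<times> UNIV"
    using set_nf[OF gc] yu by auto
  have gH: "word_value G (y @ u @ inv_word y) \<in> H"
    using word_value_nf[OF gc] yu H by simp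
  have "occurrences w u = 0" "occurrences (inv_word w) u = 0"
    using occurrences_separable[OF B w H(1) gH s yu(2)]
      occurrences_separable[OF B _ all_transitions_inv_word[OF w(2)] H(1) gH s yu(2)] w by simp_all
  then have "brooks w u = 0"
    by (simp add: brooks_def)
  then show ?thesis
    using brooks_append[of w y "u @ inv_word y"] brooks_append[of w u "inv_word y"]
      brooks_inv_word[OF w(1), of y] unfolding yu(1) by simp
qed

end

section \<open>Two independent words\<close>

text \<open>The neighbours forbid one letter each, and \<open>a\<close>, its inverse and
  \<open>b\<close> are three candidates.\<close>

lemma connecting_letter:
  assumes "a \<in> B" "b \<in> B" "a \<noteq> b" and s: "s \<noteq> []" "reduced_word s" and t: "t \<noteq> []" "reduced_word t"
  obtains c where "c \<in> B \<times> UNIV" "reduced_word (s @ c # t)"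
proof -
  have "\<exists>c\<in>{(a, True), (a, False), (b, True)}. c \<noteq> p \<and> c \<noteq> q" for p q :: "'a \<times> bool"
    using assms(3) by (cases p; cases q) auto
  then obtain c where c: "c \<in> {(a, True), (a, False), (b, True)}"
    "c \<noteq> inv_letter (last s)" "c \<noteq> inv_letter (hd t)"
    by metis
  have "hd t \<noteq> inv_letter c"
    using c(3) by (metis inv_letter_inv_letter)
  then have "reduced_word (s @ c # t)"
    using s t c by (auto simp: reduced_word_append reduced_word_Cons)
  then show ?thesis
    using that[of c] c(1) assms by auto
qed

text \<open>The required pairs are appended one by one through connecting letters. The letter
  \<open>b\<close> is put at both ends so that the word can later be joined to blocks of
  \<open>a\<close> and repeated without cancellation.\<close>

lemma word_with_all_transitions:
  assumes ab: "a \<in> B" "b \<in> B" "a \<noteq> b" and B: "finite B"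
  obtains v where "set v \<subseteq> B \<times> UNIV" "reduced_word v" "all_transitions B v"
    "v \<noteq> []" "hd v = (b, True)" "last v = (b, True)"
proof -
  let ?T = "{(x, y). x \<in> B \<times> (UNIV :: bool set) \<and> y \<in> B \<times> (UNIV :: bool set) \<and> y \<noteq> inv_letter x}"
  have "finite ((B \<times> (UNIV :: bool set)) \<times> (B \<times> (UNIV :: bool set)))"
    using B by simp
  then have "finite ?T"
    by (rule rev_finite_subset) auto
  have "\<exists>v. set v \<subseteq> B \<times> UNIV \<and> reduced_word v \<and> v \<noteq> [] \<and> (\<forall>(x, y)\<in>T. sublist [x, y] v)"
    if "finite T" "T \<subseteq> ?T" for T
    using that
  proof induction
    case empty
    show ?case
      using ab by (intro exI[of _ "[(a, True)]"]) (auto simp: reduced_word_Cons)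
  next
    case (insert z T)
    obtain x y where z: "z = (x, y)"
      by (cases z)
    then have xy: "x \<in> B \<times> UNIV" "y \<in> B \<times> UNIV" "y \<noteq> inv_letter x"
      using insert.prems by auto
    obtain v where v: "set v \<subseteq> B \<times> UNIV" "reduced_word v" "v \<noteq> []" "\<forall>(x, y)\<in>T. sublist [x, y] v"
      using insert.IH insert.prems by auto
    have "reduced_word [x, y]"
      using xy by (simp add: reduced_word_Cons)
    then obtain c where c: "c \<in> B \<times> UNIV" "reduced_word (v @ c # [x, y])"
      using connecting_letter[OF ab v(3,2), of "[x, y]"] by auto
    have "sublist v (v @ c # [x, y])" "sublist [x, y] (v @ c # [x, y])"
      by (auto intro: sublist_appendI simp: sublist_def) (metis append_Cons append_Nil append_Nil2 append_assoc)
    then show ?case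
      using v c xy z by (intro exI[of _ "v @ c # [x, y]"]) (auto intro: sublist_order.order_trans)
  qed
  from this[OF \<open>finite ?T\<close>] obtain v where v: "set v \<subseteq> B \<times> UNIV" "reduced_word v" "v \<noteq> []"
    "\<forall>(x, y)\<in>?T. sublist [x, y] v"
    by blast
  let ?b = "[(b, True)]"
  have b: "reduced_word ?b" "?b \<noteq> []"
    by (auto simp: reduced_word_Cons)
  obtain c where c: "c \<in> B \<times> UNIV" "reduced_word (v @ c # ?b)"
    using connecting_letter[OF ab v(3,2) b(2,1)] by blast
  obtain d where d: "d \<in> B \<times> UNIV" "reduced_word (?b @ d # v @ c # ?b)"
    using connecting_letter[OF ab b(2,1) _ c(2)] by auto
  have "?b @ d # v @ c # ?b = (?b @ [d]) @ v @ (c # ?b)"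
    by simp
  then have sub: "sublist v (?b @ d # v @ c # ?b)"
    by (metis sublist_appendI)
  have "all_transitions B v"
    using v(4) by (auto simp: all_transitions_def)
  then have "all_transitions B (?b @ d # v @ c # ?b)"
    by (rule all_transitions_sublist[OF _ sub])
  then show ?thesis
    using that[of "?b @ d # v @ c # ?b"] c d v ab by auto
qed

section \<open>Which words occur in powers of a marked word\<close>

lemma nth_word_power: "i < k * length u \<Longrightarrow> word_power k u ! i = u ! (i mod length u)"
proof (induction k arbitrary: i)
  case (Suc k)
  then show ?case
    by (cases "i < length u") (auto simp: word_power_Suc nth_append le_mod_geq)
qed simp

lemma occurrences_word_power: "u \<noteq> [] \<Longrightarrow> k \<le> occurrences u (word_power k u)"
proof (induction k)
  case (Suc k)
  have "occurrences u u \<noteq> 0"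
    using Suc.prems by (simp add: occurrences_eq_0_iff)
  then show ?case
    using Suc occurrences_append_ge[of u u "word_power k u"] by (simp add: word_power_Suc)
qed simp

text \<open>
  The block of \<open>L\<close> letters \<open>a\<close> is longer than \<open>v\<close>, so it can be recognized in every subword:
  it distinguishes the words for different \<open>L\<close> and fixes their orientation.
\<close>
definition marked_word :: "'a \<Rightarrow> 'a \<Rightarrow> ('a \<times> bool) list \<Rightarrow> nat \<Rightarrow> ('a \<times> bool) list" where
  "marked_word a b v L = (b, True) # replicate L (a, True) @ v"

context
  fixes a b :: 'a and v :: "('a \<times> bool) list"
  assumes ab: "a \<noteq> b" and v: "reduced_word v" "v \<noteq> []" "hd v = (b, True)" "last v = (b, True)"
begin

lemma length_marked_word [simp]: "length (marked_word a b v L) = Suc (L + length v)"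
  by (simp add: marked_word_def)

lemma nth_marked_word:
  "i \<le> L \<Longrightarrow> marked_word a b v L ! i = (if i = 0 then (b, True) else (a, True))"
  by (cases i) (auto simp: marked_word_def nth_append)

lemma reduced_marked_word:
  assumes "L > 0"
  shows "reduced_word (marked_word a b v L @ marked_word a b v L)"
proof -
  have "reduced_word (replicate n (a, True))" for n
    by (induction n) (auto simp: reduced_word_Cons hd_replicate)
  then show ?thesis
    using v assms by (auto simp: marked_word_def reduced_word_append reduced_word_Cons hd_append)
qed

text \<open>The inverse contains \<open>L\<close> consecutive negative letters \<open>a\<close>. In
  each period of the power the first \<open>M + 1\<close> letters are positive, which leaves room
  for at most \<open>length v < L\<close> consecutive negative ones.\<close>

lemma inv_marked_word_not_sublist:
  assumes "length v < L"
  shows "\<not> sublist (inv_word (marked_word a b v L)) (word_power k (marked_word a b v M))"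
proof
  let ?w = "marked_word a b v M"
  define n where "n = length ?w"
  have n: "n = Suc (M + length v)"
    by (simp add: n_def)
  assume "sublist (inv_word (marked_word a b v L)) (word_power k ?w)"
  then obtain p s where ps: "word_power k ?w = p @ inv_word (marked_word a b v L) @ s"
    by (auto simp: sublist_def)
  have "inv_word (replicate L (a, True)) = replicate L (a, False)"
    by (simp add: inv_word_def)
  then have "inv_word (marked_word a b v L) = inv_word v @ replicate L (a, False) @ [(b, False)]"
    by (simp add: marked_word_def)
  then have w: "word_power k ?w = (p @ inv_word v) @ replicate L (a, False) @ (b, False) # s"
    using ps by simp
  define q where "q = length (p @ inv_word v)"
  have len: "k * n = q + L + Suc (length s)"
    using arg_cong[OF w, of length] by (simp add: q_def n_def)
  have letter: "?w ! ((q + j) mod n) = (a, False)" if "j < L" for j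
  proof -
    have "word_power k ?w ! (q + j) = (a, False)"
      unfolding w q_def by (simp only: nth_append_length_plus) (use that in \<open>simp add: nth_append\<close>)
    then show ?thesis
      using nth_word_power[of "q + j" k ?w] len that unfolding n_def[symmetric] by simp
  qed
  have gt: "M < (q + j) mod n" if "j < L" for j
    using letter[OF that] nth_marked_word[of "(q + j) mod n" M] by (cases "(q + j) mod n \<le> M") (auto split: if_splits)
  define r where "r = q mod n"
  have r: "M < r" "r < n"
    using gt[of 0] assms n by (auto simp: r_def)
  \<comment> \<open>At offset \<open>n - r\<close> the run of negative letters would reach the start
    of the next period.\<close>
  have "q + (n - r) = n * (q div n) + n"
    using r mult_div_mod_eq[of n q] unfolding r_def[symmetric] by linarith
  then have "(q + (n - r)) mod n = 0"
    by simp
  moreover have "n - r < L"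
    using r n assms by linarith
  ultimately show False
    using gt[of "n - r"] by simp
qed

text \<open>The cases are the places in a period where the initial \<open>b\<close> can fall. At the
  start, the block of \<open>a\<close> would have to end too early, as \<open>L < M\<close>. Within
  the block the letter is \<open>a\<close>. Within \<open>v\<close>, the following \<open>L\<close>
  letters \<open>a\<close> would run over the \<open>b\<close> that opens the next period.\<close>

lemma marked_word_not_sublist:
  assumes "length v < L" "L < M"
  shows "\<not> sublist (marked_word a b v L) (word_power k (marked_word a b v M))"
proof
  let ?w = "marked_word a b v M"
  define n where "n = length ?w"
  have n: "n = Suc (M + length v)"
    by (simp add: n_def)
  assume "sublist (marked_word a b v L) (word_power k ?w)"
  then obtain p s where w: "word_power k ?w = p @ marked_word a b v L @ s"
    by (auto simp: sublist_def)
  define q where "q = length p"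
  have len: "k * n = q + Suc (L + length v) + length s"
    using arg_cong[OF w, of length] by (simp add: q_def n_def)
  have letter: "?w ! ((q + j) mod n) = marked_word a b v L ! j" if "j < Suc (L + length v)" for j
  proof -
    have "word_power k ?w ! (q + j) = marked_word a b v L ! j"
      unfolding w q_def by (simp only: nth_append_length_plus) (use that in \<open>simp add: nth_append\<close>)
    then show ?thesis
      using nth_word_power[of "q + j" k ?w] len that unfolding n_def[symmetric] by simp
  qed
  define r where "r = q mod n"
  have "r < n"
    using n by (simp add: r_def)
  have letter_r: "?w ! r = (b, True)"
    using letter[of 0] nth_marked_word[of 0 L] by (simp add: r_def)
  consider "r = 0" | "0 < r" "r \<le> M" | "M < r"
    by linarith
  then show False
  proof cases
    case 1
    then have "(q + Suc L) mod n = Suc L mod n"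
      unfolding r_def by (metis add.left_neutral mod_add_left_eq)
    also have "\<dots> = Suc L"
      using assms n by simp
    finally have "?w ! Suc L = marked_word a b v L ! Suc L"
      using letter[of "Suc L"] v(2) by simp
    moreover have "marked_word a b v L ! Suc L = (b, True)"
      using v by (simp add: marked_word_def nth_append hd_conv_nth)
    ultimately show False
      using nth_marked_word[of "Suc L" M] assms ab by simp
  next
    case 2
    then show False
      using letter_r nth_marked_word[of r M] ab by simp
  next
    case 3
    have "q + (n - r) = n * (q div n) + n"
      using \<open>r < n\<close> mult_div_mod_eq[of n q] unfolding r_def[symmetric] by linarith
    then have "(q + (n - r)) mod n = 0"
      by simp
    moreover have "0 < n - r" "n - r \<le> L"
      using 3 \<open>r < n\<close> n assms by linarith+
    ultimately show False
      using letter[of "n - r"] nth_marked_word[of "n - r" L] nth_marked_word[of 0 M] ab by simp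
  qed
qed

end

section \<open>Automorphisms, primitive and separable elements\<close>

context group
begin

lemma free_basis_image:
  assumes "free_basis G B" and \<phi>: "\<phi> \<in> iso G G"
  shows "free_basis G (\<phi> ` B)"
proof -
  interpret \<phi>: group_hom G G \<phi>
    using \<phi> by (simp add: group_hom_def group_hom_axioms_def iso_def group_axioms)
  have bij: "bij_betw \<phi> (carrier G) (carrier G)"
    using \<phi> by (simp add: iso_def)
  have B: "B \<subseteq> carrier G" "generate G B = carrier G"
    and free: "\<And>w. w \<noteq> [] \<Longrightarrow> set w \<subseteq> B \<times> UNIV \<Longrightarrow> reduced_word w \<Longrightarrow> word_value G w \<noteq> \<one>"
    using assms(1) by (auto simp: free_basis_def)
  have val: "word_value G (map (map_prod \<phi> id) w) = \<phi> (word_value G w)" if "set w \<subseteq> carrier G \<times> UNIV" for w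
    using that by (induction w) auto
  show ?thesis
    unfolding free_basis_def
  proof (intro conjI allI impI)
    show "\<phi> ` B \<subseteq> carrier G"
      using B by auto
    show "generate G (\<phi> ` B) = carrier G"
      using \<phi>.generate_img[OF B(1)] B(2) bij by (simp add: bij_betw_def)
    fix w assume w: "w \<noteq> []" "set w \<subseteq> \<phi> ` B \<times> UNIV" "reduced_word w"
    define v where "v = map (map_prod (inv_into B \<phi>) id) w"
    have wv: "w = map (map_prod \<phi> id) v"
      using w(2) unfolding v_def by (induction w) (auto simp: f_inv_into_f)
    have v: "set v \<subseteq> B \<times> UNIV"
      using w(2) unfolding v_def by (auto intro!: inv_into_into)
    have "reduced_word v"
      using w(3) unfolding wv reduced_word_def successively_map
      by (rule successively_mono) (auto simp: map_prod_def split: prod.splits)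
    then have "word_value G v \<noteq> \<one>"
      using free v w(1) wv by auto
    moreover have c: "set v \<subseteq> carrier G \<times> UNIV"
      using v B by blast
    ultimately have "\<phi> (word_value G v) \<noteq> \<phi> \<one>"
      using bij word_value_closed[OF c] by (metis bij_betw_def inj_on_eq_iff one_closed)
    then show "word_value G w \<noteq> \<one>"
      using val[OF c] wv by simp
  qed
qed

text \<open>An alternating word over the images is pulled back syllable by syllable. Applied to
  inner automorphisms, this gives the conjugation invariance of separable elements.\<close>

lemma proper_free_factor_image:
  assumes "proper_free_factor G H" and \<phi>: "\<phi> \<in> iso G G"
  shows "proper_free_factor G (\<phi> ` H)"
proof -
  interpret \<phi>: group_hom G G \<phi>
    using \<phi> by (simp add: group_hom_def group_hom_axioms_def iso_def group_axioms)
  have bij: "bij_betw \<phi> (carrier G) (carrier G)"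
    using \<phi> by (simp add: iso_def)
  then have inj: "inj_on \<phi> (carrier G)"
    by (simp add: bij_betw_def)
  obtain K where K: "nontrivial_proper_subgroup G K" "free_product_decomp G H K"
    and H: "nontrivial_proper_subgroup G H"
    using assms(1) by (auto simp: proper_free_factor_def)
  have sub: "nontrivial_proper_subgroup G (\<phi> ` L)" if L: "nontrivial_proper_subgroup G L" for L
  proof -
    have L: "subgroup L G" "L \<noteq> {\<one>}" "L \<noteq> carrier G"
      using L by (auto simp: nontrivial_proper_subgroup_def)
    have Lc: "L \<subseteq> carrier G"
      using L(1) by (rule subgroup.subset)
    have "\<phi> ` L \<noteq> \<phi> ` {\<one>}" "\<phi> ` L \<noteq> \<phi> ` carrier G"
      using inj_on_image_eq_iff[OF inj Lc, of "{\<one>}"] inj_on_image_eq_iff[OF inj Lc, of "carrier G"]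
        L(2,3) by simp_all
    moreover have "\<phi> ` carrier G = carrier G"
      using bij by (simp add: bij_betw_def)
    ultimately show ?thesis
      using \<phi>.subgroup_img_is_subgroup[OF L(1)] by (simp add: nontrivial_proper_subgroup_def)
  qed
  interpret free_product G H K
    by unfold_locales (rule K)
  have c: "H \<subseteq> carrier G" "K \<subseteq> carrier G"
    using factor_carrier[of _ True] factor_carrier[of _ False] by (auto simp: factor_def)
  have "free_product_decomp G (\<phi> ` H) (\<phi> ` K)"
    unfolding free_product_decomp_def
  proof (intro conjI allI impI)
    show "subgroup (\<phi> ` H) G" "subgroup (\<phi> ` K) G"
      using sub[OF H] sub[OF K(1)] by (auto simp: nontrivial_proper_subgroup_def)
    have "generate G (\<phi> ` (H \<union> K)) = carrier G"
      using \<phi>.generate_img[of "H \<union> K"] decomp c bij by (simp add: free_product_decomp_def bij_betw_def)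
    then show "generate G (\<phi> ` H \<union> \<phi> ` K) = carrier G"
      by (simp add: image_Un)
    fix w :: "(bool \<times> 'a) list"
    assume w: "w \<noteq> []" "\<forall>(i, x)\<in>set w. x \<in> (if i then \<phi> ` H else \<phi> ` K) \<and> x \<noteq> \<one>"
      "successively (\<lambda>(i, x) (j, y). i \<noteq> j) w"
    define v where "v = map (\<lambda>(i, x). (i, inv_into (factor i) \<phi> x)) w"
    have wf: "snd s \<in> \<phi> ` factor (fst s)" "snd s \<noteq> \<one>" if "s \<in> set w" for s
      using w(2) that by (auto simp: factor_def split: if_splits)
    have v1: "snd t \<in> factor (fst t) \<and> \<phi> (snd t) \<noteq> \<one>" if "t \<in> set v" for t
    proof -
      obtain i x where x: "(i, x) \<in> set w" "t = (i, inv_into (factor i) \<phi> x)"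
        using \<open>t \<in> set v\<close> by (auto simp: v_def)
      then have "x \<in> \<phi> ` factor i" "x \<noteq> \<one>"
        using wf[of "(i, x)"] by auto
      then show ?thesis
        using x by (auto simp: f_inv_into_f intro: inv_into_into)
    qed
    have "successively (\<lambda>s t. fst s \<noteq> fst t) v"
      using w(3) unfolding v_def successively_map by (rule successively_mono) auto
    then have sv: "syllable_word v"
      using v1 by (fastforce simp: syllable_word_def)
    have "foldr (\<lambda>(i, x) g. x \<otimes> g) w \<one> = \<phi> (syllable_value v)"
      using sv wf unfolding v_def
    proof (induction w)
      case (Cons s w)
      obtain i x where s: "s = (i, x)"
        by (cases s)
      have "x \<in> \<phi> ` factor i"
        using Cons.prems(2)[of s] s by simp
      then have "\<phi> (inv_into (factor i) \<phi> x) = x" "inv_into (factor i) \<phi> x \<in> carrier G"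
        using factor_carrier inv_into_into[of x \<phi> "factor i"] by (auto simp: f_inv_into_f)
      then show ?case
        using Cons s by (auto simp: syllable_word_Cons)
    qed simp
    moreover have "syllable_value v \<noteq> \<one>"
      using syllable_value_neq_one[OF sv] w(1) by (simp add: v_def)
    ultimately show "foldr (\<lambda>(i, x) g. x \<otimes> g) w \<one> \<noteq> \<one>"
      using inj_onD[OF inj, of "syllable_value v" \<one>] sv by auto
  qed
  then show ?thesis
    using sub[OF H] sub[OF K(1)] by (auto simp: proper_free_factor_def)
qed

lemma conj_iso:
  assumes y: "y \<in> carrier G"
  shows "(\<lambda>x. y \<otimes> x \<otimes> inv y) \<in> iso G G"
proof (rule isoI)
  have c: "inv y \<otimes> (y \<otimes> x) = x" "y \<otimes> (inv y \<otimes> x) = x" if "x \<in> carrier G" for x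
    using that y by (simp_all add: m_assoc[symmetric])
  show "(\<lambda>x. y \<otimes> x \<otimes> inv y) \<in> hom G G"
    using y c by (intro homI) (auto simp: m_assoc)
  show "bij_betw (\<lambda>x. y \<otimes> x \<otimes> inv y) (carrier G) (carrier G)"
    by (rule bij_betw_byWitness[where f' = "\<lambda>x. inv y \<otimes> x \<otimes> y"])
      (use y c in \<open>auto simp: m_assoc\<close>)
qed

text \<open>Replacing each letter \<open>(b, e)\<close> by \<open>(inv b, \<not> e)\<close> changes
  neither the value of a word nor its being reduced.\<close>

lemma free_basis_inv:
  assumes "free_basis G B"
  shows "free_basis G ((\<lambda>b. inv b) ` B)"
proof -
  have B: "B \<subseteq> carrier G" "generate G B = carrier G"
    and free: "\<And>w. w \<noteq> [] \<Longrightarrow> set w \<subseteq> B \<times> UNIV \<Longrightarrow> reduced_word w \<Longrightarrow> word_value G w \<noteq> \<one>"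
    using assms by (auto simp: free_basis_def)
  have ic: "(\<lambda>b. inv b) ` B \<subseteq> carrier G"
    using B by auto
  show ?thesis
    unfolding free_basis_def
  proof (intro conjI allI impI)
    show "(\<lambda>b. inv b) ` B \<subseteq> carrier G"
      by (rule ic)
    have "B \<subseteq> generate G ((\<lambda>b. inv b) ` B)"
    proof
      fix b assume "b \<in> B"
      then show "b \<in> generate G ((\<lambda>b. inv b) ` B)"
        using generate.inv[of "inv b" "(\<lambda>b. inv b) ` B" G] B by auto
    qed
    then have "generate G B \<subseteq> generate G ((\<lambda>b. inv b) ` B)"
      by (rule generate_subgroup_incl) (rule generate_is_subgroup[OF ic])
    then show "generate G ((\<lambda>b. inv b) ` B) = carrier G"
      using B(2) generate_incl[OF ic] by auto
    fix w :: "('a \<times> bool) list"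
    assume w: "w \<noteq> []" "set w \<subseteq> (\<lambda>b. inv b) ` B \<times> UNIV" "reduced_word w"
    let ?f = "\<lambda>(b, e). (inv b, \<not> e)"
    have "set (map ?f w) \<subseteq> B \<times> UNIV"
    proof
      fix p assume "p \<in> set (map ?f w)"
      then obtain a e where a: "(a, e) \<in> set w" "p = (inv a, \<not> e)"
        by auto
      then have "a \<in> (\<lambda>b. inv b) ` B"
        using w(2) by blast
      then show "p \<in> B \<times> UNIV"
        using a B by auto
    qed
    moreover have wc: "set w \<subseteq> carrier G \<times> UNIV"
      using w(2) ic by blast
    have "reduced_word (map ?f w)"
      using w(3) unfolding reduced_word_def successively_map
    proof (rule successively_mono)
      fix x y
      assume "x \<in> set w" "y \<in> set w" and P: "(\<lambda>(a, e) (b, f). \<not> (a = b \<and> e \<noteq> f)) x y"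
      then have "x \<in> carrier G \<times> UNIV" "y \<in> carrier G \<times> UNIV"
        using wc by blast+
      then have "inv (fst x) = inv (fst y) \<longleftrightarrow> fst x = fst y"
        by (metis inv_inv mem_Times_iff)
      then show "(\<lambda>(a, e) (b, f). \<not> (a = b \<and> e \<noteq> f)) (?f x) (?f y)"
        using P by (cases x; cases y) auto
    qed
    ultimately have "word_value G (map ?f w) \<noteq> \<one>"
      using free w(1) by simp
    moreover have "word_value G (map ?f w) = word_value G w"
      using wc by (induction w) auto
    ultimately show "word_value G w \<noteq> \<one>"
      by simp
  qed
qed

text \<open>The splitting has the cyclic group of \<open>b\<close> and the group generated by
  \<open>B - {b}\<close> as factors. Reduced words over disjoint alphabets concatenate without
  cancellation, so alternating products are spelled by nonempty reduced words. The element
  \<open>c\<close> makes the second factor nontrivial.\<close>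

lemma basis_element_separable:
  assumes B: "free_basis G B" and b: "b \<in> B" and c: "c \<in> B" "b \<noteq> c"
  shows "b \<in> separable_elements G"
proof -
  interpret free_group_basis G B
    by unfold_locales (rule B)
  define S where "S i = (if i then {b} else B - {b})" for i
  define L where "L i = generate G (S i)" for i
  have SB: "S i \<subseteq> B" "S i \<subseteq> carrier G" for i
    using b basis_carrier by (auto simp: S_def)
  have sub: "subgroup (L i) G" for i
    unfolding L_def by (rule generate_is_subgroup[OF SB(2)])
  have concat: "\<exists>u. set u \<subseteq> B \<times> UNIV \<and> reduced_word u \<and>
      word_value G u = foldr (\<lambda>(i, x) g. x \<otimes> g) w \<one> \<and> u \<noteq> [] \<and> fst (hd u) \<in> S (fst (hd w))"
    if "w \<noteq> []" "\<forall>(i, x)\<in>set w. x \<in> L i \<and> x \<noteq> \<one>" "successively (\<lambda>(i, x) (j, y). i \<noteq> j) w"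
    for w
    using that
  proof (induction w)
    case (Cons s w)
    obtain i x where s: "s = (i, x)"
      by (cases s)
    then have x: "x \<in> generate G (S i)" "x \<noteq> \<one>"
      using Cons.prems by (auto simp: L_def)
    obtain r where r: "set r \<subseteq> S i \<times> UNIV" "reduced_word r" "word_value G r = x"
      using reduced_word_exists[OF SB(2) x(1)] by blast
    then have r0: "r \<noteq> []"
      using x by auto
    then have "hd r \<in> S i \<times> UNIV" "last r \<in> S i \<times> UNIV"
      using r(1) hd_in_set[of r] last_in_set[of r] by blast+
    then have hr: "fst (hd r) \<in> S i" "fst (last r) \<in> S i"
      by auto
    have rB: "set r \<subseteq> B \<times> UNIV"
      using r(1) SB(1)[of i] by blast
    show ?case
    proof (cases "w = []")
      case True
      have "x \<in> carrier G"
        using word_value_closed[OF words_carrier[OF rB]] r(3) by simp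
      then show ?thesis
        using r r0 rB hr s True by (intro exI[of _ r]) auto
    next
      case False
      then obtain u where u: "set u \<subseteq> B \<times> UNIV" "reduced_word u"
        "word_value G u = foldr (\<lambda>(i, x) g. x \<otimes> g) w \<one>" "u \<noteq> []" "fst (hd u) \<in> S (fst (hd w))"
        using Cons by (auto simp: successively_Cons)
      have "fst (hd w) = (\<not> i)"
        using Cons.prems(3) s False by (auto simp: successively_Cons split: prod.splits)
      then have "fst (hd u) \<noteq> fst (last r)"
        using u(5) hr by (auto simp: S_def split: if_splits)
      then have "hd u \<noteq> inv_letter (last r)"
        by (cases "last r") auto
      then have "reduced_word (r @ u)"
        using r u by (simp add: reduced_word_append)
      moreover have "word_value G (r @ u) = x \<otimes> word_value G u"
        using word_value_append[OF words_carrier[OF rB] words_carrier[OF u(1)]] r(3) by simp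
      ultimately show ?thesis
        using r0 rB hr u s by (intro exI[of _ "r @ u"]) auto
    qed
  qed simp
  have nt: "foldr (\<lambda>(i, x) g. x \<otimes> g) w \<one> \<noteq> \<one>"
    if w: "w \<noteq> []" "\<forall>(i, x)\<in>set w. x \<in> (if i then L True else L False) \<and> x \<noteq> \<one>"
      "successively (\<lambda>(i, x) (j, y). i \<noteq> j) w" for w
  proof -
    have "\<forall>(i, x)\<in>set w. x \<in> L i \<and> x \<noteq> \<one>"
      using w(2) by (force split: if_splits)
    from concat[OF w(1) this w(3)] obtain u where "set u \<subseteq> B \<times> UNIV" "reduced_word u"
      "word_value G u = foldr (\<lambda>(i, x) g. x \<otimes> g) w \<one>" "u \<noteq> []"
      by blast
    then show ?thesis
      using reduced_word_value by metis
  qed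
  have "B \<subseteq> L True \<union> L False"
    using generate.incl[of _ "S True" G] generate.incl[of _ "S False" G] by (auto simp: L_def S_def)
  then have "generate G B \<subseteq> generate G (L True \<union> L False)"
    by (rule mono_generate)
  moreover have "generate G (L True \<union> L False) \<subseteq> carrier G"
    using sub[THEN subgroup.subset] by (intro generate_incl) auto
  ultimately have "generate G (L True \<union> L False) = carrier G"
    using generate_basis by auto
  then have decomp: "free_product_decomp G (L True) (L False)"
    unfolding free_product_decomp_def using sub nt by blast
  have mem: "b \<in> L True" "c \<in> L False"
    unfolding L_def S_def using c by (auto intro!: generate.incl)
  have ne: "x \<noteq> \<one>" if "x \<in> B" for x
    using reduced_word_value[of "[(x, True)]"] that basis_carrier by (auto simp: reduced_word_Cons)
  have disj: "x = \<one>" if "x \<in> L True" "x \<in> L False" for x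
  proof (rule ccontr)
    assume x: "x \<noteq> \<one>"
    have "x \<in> carrier G" "inv x \<in> L False"
      using that sub subgroup.mem_carrier subgroup.m_inv_closed by metis+
    then show False
      using nt[of "[(True, x), (False, inv x)]"] that x by (auto simp: inv_eq_1_iff)
  qed
  have "nontrivial_proper_subgroup G (L True)" "nontrivial_proper_subgroup G (L False)"
    unfolding nontrivial_proper_subgroup_def
    using sub mem disj[of b] disj[of c] ne[OF b] ne[OF c(1)] b c basis_carrier by auto
  then show ?thesis
    unfolding separable_elements_def proper_free_factor_def using decomp mem by blast
qed

end

section \<open>Nonhyperbolicity\<close>

lemma (in free_group_basis) not_hyperbolic_cayley_graph:
  assumes B: "finite B" "a \<in> B" "b \<in> B" "a \<noteq> b"
    and S: "normal_generating_set G S" "S \<subseteq> separable_elements G"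
  shows "\<not> hyperbolic_graph (cayley_graph G S)"
proof -
  interpret normal_generating_set G S
    by (rule S)
  obtain v where v: "set v \<subseteq> B \<times> UNIV" "reduced_word v" "all_transitions B v"
    "v \<noteq> []" "hd v = (b, True)" "last v = (b, True)"
    using word_with_all_transitions[OF B(2,3,4,1)] by blast
  note marked = B(4) v(2,4,5,6)
  \<comment> \<open>The offset makes every block of \<open>a\<close> longer than \<open>v\<close>,
    and \<open>w 1\<close> has one letter \<open>a\<close> more than \<open>w 0\<close>.\<close>
  define w where "w i = marked_word a b v (Suc (length v) + i)" for i
  have w: "set (w i) \<subseteq> B \<times> UNIV" "w i \<noteq> []" "reduced_word (w i @ w i)" "all_transitions B (w i)" for i
  proof -
    show "set (w i) \<subseteq> B \<times> UNIV"
      using v B by (auto simp: w_def marked_word_def)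
    show "w i \<noteq> []"
      by (simp add: w_def marked_word_def)
    show "reduced_word (w i @ w i)"
      unfolding w_def by (rule reduced_marked_word[OF marked]) simp
    have "sublist v (w i)"
      unfolding w_def marked_word_def by (metis append_Cons append_Nil2 sublist_appendI)
    then show "all_transitions B (w i)"
      by (rule all_transitions_sublist[OF v(3)])
  qed
  have no_inv: "occurrences (inv_word (w i)) (word_power k (w j)) = 0" for i j k
    unfolding w_def
    by (subst occurrences_eq_0_iff, use w[of i] in \<open>simp add: w_def\<close>)
      (rule inv_marked_word_not_sublist[OF marked], simp)
  have no_pos: "occurrences (w 0) (word_power k (w 1)) = 0" for k
    unfolding w_def
    by (subst occurrences_eq_0_iff, use w[of 0] in \<open>simp add: w_def\<close>)
      (rule marked_word_not_sublist[OF marked], simp_all)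
  define g where "g i = word_value G (w i)" for i
  have g: "g i \<in> carrier G" for i
    unfolding g_def by (rule word_value_closed[OF words_carrier[OF w(1)]])
  have power: "word_value G (word_power k (w i)) = g i [^] k" for i k
  proof (induction k)
    case (Suc k)
    have "set (word_power k (w i)) \<subseteq> B \<times> UNIV"
      using set_word_power[of k "w i"] w(1)[of i] by blast
    then show ?case
      using word_value_append[OF words_carrier words_carrier[OF w(1)], of "word_power k (w i)" i] Suc
      by (simp add: word_power_Suc_right g_def)
  qed simp
  have nf_power: "nf (g i [^] k) = word_power k (w i)" for i k
    using set_word_power[of k "w i"] w(1)[of i] reduced_word_power[OF w(3)[of i]] power
    by (intro nf_eqI) auto
  define \<phi> where "\<phi> i x = brooks (w i) (nf x)" for i x
  \<comment> \<open>One constant for both functions: it dominates the defect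
    \<open>3 * length (w i)\<close> and the bound \<open>2 * length (w i)\<close> on separable
    elements.\<close>
  define D where "D = 3 * (length (w 0) + length (w 1))"
  have i01: "i \<in> {0, 1} \<Longrightarrow> length (w i) \<le> length (w 0) + length (w 1)" for i
    by auto
  have qm: "quasimorphism G D (\<phi> i)" if "i \<in> {0, 1}" for i
    using quasimorphism_brooks[OF w(2)[of i]] i01[OF that]
    unfolding quasimorphism_def \<phi>_def D_def by fastforce
  have bounded: "\<bar>\<phi> i s\<bar> \<le> int D" if "s \<in> S" "i \<in> {0, 1}" for i s
    using brooks_separable[OF B(1) w(2,4), of s i] S(2) i01[OF that(2)] that(1)
    unfolding \<phi>_def D_def by fastforce
  have large: "int k \<le> \<phi> i (g i [^] k)" for i k
    using occurrences_word_power[OF w(2), of k i] no_inv by (simp add: \<phi>_def nf_power brooks_def)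
  have zero: "\<phi> 0 (g 1 [^] k) = 0" for k :: nat
    using no_inv[of 0 k 1] no_pos[of k] by (simp add: \<phi>_def nf_power brooks_def)
  show ?thesis
    using not_hyperbolic_if_quasimorphisms[OF qm[of 0] qm[of 1] bounded[of _ 0] bounded[of _ 1]
        g[of 0] g[of 1] large[of _ 0] _ large[of _ 1], of 0] zero by simp
qed

section \<open>Closure properties of the separable and the primitive elements\<close>

context group
begin

lemma separable_elements_carrier: "separable_elements G \<subseteq> carrier G"
  using subgroup.mem_carrier
  by (force simp: separable_elements_def proper_free_factor_def nontrivial_proper_subgroup_def)

lemma separable_elements_inv:
  assumes "g \<in> separable_elements G"
  shows "inv g \<in> separable_elements G"
proof -
  obtain H where H: "proper_free_factor G H" "g \<in> H"
    using assms unfolding separable_elements_def by blast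
  then have "subgroup H G"
    by (simp add: proper_free_factor_def nontrivial_proper_subgroup_def)
  then have "inv g \<in> H"
    using H(2) by (rule subgroup.m_inv_closed)
  with H(1) show ?thesis
    unfolding separable_elements_def by blast
qed

lemma separable_elements_conj:
  assumes "g \<in> separable_elements G" "y \<in> carrier G"
  shows "y \<otimes> g \<otimes> inv y \<in> separable_elements G"
proof -
  obtain H where H: "proper_free_factor G H" "g \<in> H"
    using assms(1) unfolding separable_elements_def by blast
  then show ?thesis
    using proper_free_factor_image[OF H(1) conj_iso[OF assms(2)]]
    unfolding separable_elements_def by blast
qed

lemma primitive_elements_carrier: "primitive_elements G \<subseteq> carrier G"
  by (auto simp: primitive_elements_def free_basis_def)

lemma primitive_elements_inv: "g \<in> primitive_elements G \<Longrightarrow> inv g \<in> primitive_elements G"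
  using free_basis_inv by (auto simp: primitive_elements_def)

lemma primitive_elements_conj:
  assumes "g \<in> primitive_elements G" "y \<in> carrier G"
  shows "y \<otimes> g \<otimes> inv y \<in> primitive_elements G"
proof -
  obtain B where B: "free_basis G B" "g \<in> B"
    using assms(1) unfolding primitive_elements_def by blast
  then show ?thesis
    using free_basis_image[OF B(1) conj_iso[OF assms(2)]]
    unfolding primitive_elements_def by blast
qed

lemma generate_supset_basis:
  assumes "free_basis G B" "B \<subseteq> S" "S \<subseteq> carrier G"
  shows "generate G S = carrier G"
  using mono_generate[OF assms(2)] generate_incl[OF assms(3)] assms(1) by (auto simp: free_basis_def)

end

lemma (in free_group_basis) not_commutative:
  assumes "a \<in> B" "b \<in> B" "a \<noteq> b"
  shows "a \<otimes> b \<noteq> b \<otimes> a"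
proof
  assume ab: "a \<otimes> b = b \<otimes> a"
  have c: "a \<in> carrier G" "b \<in> carrier G"
    using assms basis_carrier by auto
  have "word_value G [(a, True), (b, True), (a, False), (b, False)] = a \<otimes> b \<otimes> inv (b \<otimes> a)"
    using c by (simp add: m_assoc inv_mult_group)
  also have "\<dots> = \<one>"
    using ab c by simp
  finally show False
    using reduced_word_value[of "[(a, True), (b, True), (a, False), (b, False)]"] assms
    by (auto simp: reduced_word_Cons)
qed

text \<open>No comparison of the sizes of two bases is made: if \<open>x\<close> were the only
  element of its basis, the group would be cyclic, whereas \<open>a\<close> and \<open>b\<close> do
  not commute.\<close>

lemma (in free_group_basis) primitive_elements_subset_separable:
  assumes ab: "a \<in> B" "b \<in> B" "a \<noteq> b"
  shows "primitive_elements G \<subseteq> separable_elements G"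
proof
  fix x assume "x \<in> primitive_elements G"
  then obtain B' where B': "free_basis G B'" "x \<in> B'"
    by (auto simp: primitive_elements_def)
  have x: "x \<in> carrier G"
    using B' by (auto simp: free_basis_def)
  have "\<exists>c\<in>B'. x \<noteq> c"
  proof (rule ccontr)
    assume none: "\<not> ?thesis"
    have "B' \<subseteq> {x}"
    proof
      fix c assume "c \<in> B'"
      then show "c \<in> {x}"
        using none by (cases "x = c") blast+
    qed
    then have "B' = {x}"
      using B'(2) by blast
    then have gen: "carrier G = {x [^] k | k. k \<in> (UNIV :: int set)}"
      using B'(1) generate_pow[OF x] by (simp add: free_basis_def)
    have "a \<in> carrier G" "b \<in> carrier G"
      using ab basis_carrier by blast+
    then obtain k l :: int where "a = x [^] k" "b = x [^] l"
      unfolding gen by blast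
    then have "a \<otimes> b = b \<otimes> a"
      using int_pow_mult[OF x, of k l] int_pow_mult[OF x, of l k] by (simp add: add.commute)
    then show False
      using not_commutative[OF ab] by simp
  qed
  then show "x \<in> separable_elements G"
    using basis_element_separable[OF B'] by blast
qed

theorem corollary1p6:
  fixes F :: "('a, 'm) monoid_scheme" and n :: nat
  assumes "n \<ge> 2"
    and "free_group_of_rank F n"
  shows "\<not> hyperbolic_graph (cayley_graph F (separable_elements F)) \<and>
           \<not> hyperbolic_graph (cayley_graph F (primitive_elements F))"
proof -
  obtain B where F: "group F" and B: "free_basis F B" "finite B" "card B = n"
    using assms(2) by (auto simp: free_group_of_rank_def)
  interpret free_group_basis F B
    using F B by (simp add: free_group_basis_def free_group_basis_axioms_def)
  obtain a b where ab: "a \<in> B" "b \<in> B" "a \<noteq> b"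
    using B assms(1) card_le_Suc0_iff_eq[of B] by auto
  note prim_sep = primitive_elements_subset_separable[OF ab]
  have B_prim: "B \<subseteq> primitive_elements F"
    using B by (auto simp: primitive_elements_def)
  have "normal_generating_set F (separable_elements F)"
    using separable_elements_carrier separable_elements_inv separable_elements_conj
      generate_supset_basis[OF B(1) order_trans[OF B_prim prim_sep]]
    by unfold_locales auto
  moreover have "normal_generating_set F (primitive_elements F)"
    using primitive_elements_carrier primitive_elements_inv primitive_elements_conj
      generate_supset_basis[OF B(1) B_prim]
    by unfold_locales auto
  ultimately show ?thesis
    using not_hyperbolic_cayley_graph[OF B(2) ab] prim_sep by blast
qed

end
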